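(* Let $q$ be a prime power and for $n\geq 1$ let $a_n$ be the number of conjugacy classes of $n \times n$ matrices over $\mathbf{F}_q$. Then the ordinary generating function for the sequence $\{a_n\}$ is given by $$1 + \sum_{n \geq 1} a_n u^n = \prod_{r \geq 1} \frac{1}{1-qu^r} .$$
   Context: $\mathbf{F}_q$ is the field with $q$ elements. Conjugacy classes of $n\times n$ matrices are the orbits of the group $\mathrm{GL}_n(q)$ of invertible $n\times n$ matrices over $\mathbf{F}_q$ acting by conjugation on the set of all $n\times n$ matrices over $\mathbf{F}_q$. The identity is one of formal power series in $u$. *)

theory Defs
  imports
    "Jordan_Normal_Form.Matrix"
    "HOL-Algebra.Group_Action"
    "HOL-Computational_Algebra.Formal_Power_Series"
    "HOL-Analysis.Infinite_Products"
    "HOL-Number_Theory.Prime_Powers"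
begin

definition GL :: "'a::field itself \<Rightarrow> nat \<Rightarrow> 'a mat monoid" where
  "GL ty n = units_of (ring_mat ty n ())"

text \<open>Restricted to the square matrices (undefined elsewhere), so that it is a
  \<^const>\<open>group_action\<close> in the library's sense.\<close>

definition mat_conj :: "nat \<Rightarrow> 'a::field mat \<Rightarrow> 'a mat \<Rightarrow> 'a mat" where
  "mat_conj n P = (\<lambda>A\<in>carrier_mat n n. P * A * inv\<^bsub>GL TYPE('a) n\<^esub> P)"

lemma group_action_mat_conj:
  "group_action (GL TYPE('a::field) n) (carrier_mat n n) (mat_conj n)"
proof -
  let ?G = "GL TYPE('a) n" and ?E = "carrier_mat n n :: 'a mat set"
  interpret R: ring "ring_mat TYPE('a) n ()" by (rule ring_mat)
  interpret G: group ?G unfolding GL_def by (rule R.units_group)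
  have car: "P \<in> ?E" if "P \<in> carrier ?G" for P
    using that by (auto simp: GL_def units_of_def Units_def ring_mat_simps)
  have mult: "P \<otimes>\<^bsub>?G\<^esub> Q = P * Q" for P Q
    by (simp add: GL_def units_of_def ring_mat_simps)
  have one: "\<one>\<^bsub>?G\<^esub> = 1\<^sub>m n"
    by (simp add: GL_def units_of_def ring_mat_simps)
  have closed: "mat_conj n P A \<in> ?E" if "P \<in> carrier ?G" "A \<in> ?E" for P A
    using that car[OF that(1)] car[OF G.inv_closed[OF that(1)]] by (auto simp: mat_conj_def)
  have comp: "mat_conj n (P * Q) A = mat_conj n P (mat_conj n Q A)"
    if P: "P \<in> carrier ?G" and Q: "Q \<in> carrier ?G" and A: "A \<in> ?E" for P Q A
  proof -
    let ?P' = "inv\<^bsub>?G\<^esub> P" and ?Q' = "inv\<^bsub>?G\<^esub> Q"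
    have c: "P \<in> ?E" "Q \<in> ?E" "?P' \<in> ?E" "?Q' \<in> ?E"
      using car P Q G.inv_closed by auto
    have i: "inv\<^bsub>?G\<^esub> (P * Q) = ?Q' * ?P'"
      using G.inv_mult_group[OF P Q] by (simp add: mult)
    have QA: "Q * A * ?Q' \<in> ?E" using c A by auto
    have "(P * Q) * A * (?Q' * ?P') = ((P * Q) * A * ?Q') * ?P'"
      using c A by (intro assoc_mult_mat[symmetric, of _ n n _ n _ n]) auto
    also have "(P * Q) * A * ?Q' = P * (Q * A * ?Q')"
      using c A by (simp add: assoc_mult_mat[of _ n n _ n _ n])
    finally show ?thesis using A QA by (simp add: mat_conj_def i)
  qed
  have id: "mat_conj n (1\<^sub>m n) A = A" if "A \<in> ?E" for A
    using that G.inv_one by (simp add: mat_conj_def one)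
  have bij: "mat_conj n P \<in> Bij ?E" if P: "P \<in> carrier ?G" for P
  proof -
    have P': "inv\<^bsub>?G\<^esub> P \<in> carrier ?G" using P by simp
    have "bij_betw (mat_conj n P) ?E ?E"
    proof (rule bij_betw_byWitness[where f' = "mat_conj n (inv\<^bsub>?G\<^esub> P)"])
      show "\<forall>A\<in>?E. mat_conj n (inv\<^bsub>?G\<^esub> P) (mat_conj n P A) = A"
        using comp[OF P' P] id G.l_inv[OF P] by (simp add: mult one)
      show "\<forall>A\<in>?E. mat_conj n P (mat_conj n (inv\<^bsub>?G\<^esub> P) A) = A"
        using comp[OF P P'] id G.r_inv[OF P] by (simp add: mult one)
    qed (use closed P P' in auto)
    then show ?thesis by (simp add: Bij_def mat_conj_def)
  qed
  have "mat_conj n \<in> hom ?G (BijGroup ?E)"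
  proof (rule homI)
    fix P Q assume P: "P \<in> carrier ?G" and Q: "Q \<in> carrier ?G"
    have "mat_conj n (P * Q) = compose ?E (mat_conj n P) (mat_conj n Q)"
      by (rule extensionalityI[of _ ?E]) (auto simp: mat_conj_def[of n "P * Q"] compose_eq
          comp[OF P Q, symmetric])
    then show "mat_conj n (P \<otimes>\<^bsub>?G\<^esub> Q) = mat_conj n P \<otimes>\<^bsub>BijGroup ?E\<^esub> mat_conj n Q"
      using bij P Q by (simp add: BijGroup_def mult)
  qed (use bij in \<open>auto simp: BijGroup_def\<close>)
  then show ?thesis
    unfolding group_action_def group_hom_def group_hom_axioms_def
    using G.group_axioms group_BijGroup by blast
qed

definition mat_conj_classes :: "'a::field itself \<Rightarrow> nat \<Rightarrow> 'a mat set set" where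
  "mat_conj_classes ty n = orbits (GL ty n) (carrier_mat n n) (mat_conj n)"

end

theory Submission
  imports
    Defs
    "HOL-Computational_Algebra.Polynomial"
    "HOL-Library.Function_Algebras"
begin

text \<open>
  Let \<open>F\<close> be the field with \<open>q\<close> elements. A matrix \<open>A\<close> turns \<open>F\<^sup>n\<close> into a module over the polynomial
  ring \<open>F[x]\<close> in which \<open>x\<close> acts as \<open>A\<close>, and two matrices are conjugate iff their modules are isomorphic
  (\<open>orbit_iff_intertwiner\<close>). So the task is to count isomorphism classes of \<open>F[x]\<close>-modules with
  \<open>q\<^sup>n\<close> elements, and this is done through invariant factors.

  For each \<open>N \<ge> n\<close> the module is a direct sum of cyclic modules \<open>F[x] / (d\<^sub>i)\<close>, \<open>i < N\<close>, for monic
  polynomials such that each \<open>d\<^sub>i\<close> divides the next one and the degrees add up to \<open>n\<close>; as the module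
  has \<open>n\<close> generators, the list can be padded in front by entries 1. Existence comes from the structure
  theorem over Euclidean rings (\<open>diagonal_generators\<close>, \<open>mat_type_exists\<close>). For uniqueness
  (\<open>monic_chain_unique\<close>) it suffices to count, for every polynomial \<open>a\<close>, the vectors killed by \<open>a\<close>: this
  number is a product over \<open>i\<close>, and it is maximal iff all \<open>d\<^sub>i\<close> divide \<open>a\<close>. Every such chain occurs
  (\<open>mat_type_realised\<close>), because the direct sum of the modules \<open>F[x] / (d\<^sub>i)\<close> has dimension \<open>n\<close>.
  Hence the number of conjugacy classes is the number of chains of length \<open>N\<close> and total degree \<open>n\<close>,
  for every \<open>N \<ge> n\<close> (\<open>card_mat_conj_classes\<close>).

  Chains are counted by dividing out the first entry (\<open>bij_betw_chains_Suc\<close>): a chain of length \<open>r\<close>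
  is a monic polynomial \<open>e\<close> together with a chain of length \<open>r - 1\<close>, and the total degree is that of
  the shorter chain plus \<open>r\<close> times the degree of \<open>e\<close>. There are \<open>q\<^sup>k\<close> monic polynomials of degree \<open>k\<close>,
  so this step multiplies the generating function by \<open>\<Sum>k. q\<^sup>k u\<^sup>r\<^sup>k = 1 / (1 - q u\<^sup>r)\<close>. The partial
  product over \<open>r \<le> N\<close> therefore counts chains of length \<open>N\<close>, and its coefficients up to \<open>u\<^sup>N\<close> are
  already the class numbers. This is convergence of formal power series.
\<close>

section \<open>Diagonal generators of modules over Euclidean rings\<close>

locale euclidean_module = Modules.module scale
  for scale :: "'a::euclidean_ring \<Rightarrow> 'b::ab_group_add \<Rightarrow> 'b" (infixr "\<star>" 75)
begin

definition comb :: "nat \<Rightarrow> (nat \<Rightarrow> 'a) \<Rightarrow> (nat \<Rightarrow> 'b) \<Rightarrow> 'b" where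
  "comb k p w = (\<Sum>i<k. p i \<star> w i)"

lemma span_family: "span (w ` {..<k}) = range (\<lambda>p. comb k p w)"
proof (rule span_unique)
  show "w ` {..<k} \<subseteq> range (\<lambda>p. comb k p w)"
  proof
    fix x assume "x \<in> w ` {..<k}"
    then obtain i where i: "i < k" "x = w i" by auto
    have "comb k (\<lambda>j. if j = i then 1 else 0) w = (\<Sum>j<k. if j = i then w j else 0)"
      unfolding comb_def by (intro sum.cong) auto
    then show "x \<in> range (\<lambda>p. comb k p w)"
      using i by (intro range_eqI[of _ _ "\<lambda>j. if j = i then 1 else 0"]) simp
  qed
  show "subspace (range (\<lambda>p. comb k p w))"
  proof (rule subspaceI)
    show "0 \<in> range (\<lambda>p. comb k p w)"
      by (rule range_eqI[of _ _ "\<lambda>_. 0"]) (simp add: comb_def)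
  next
    fix x y assume "x \<in> range (\<lambda>p. comb k p w)" "y \<in> range (\<lambda>p. comb k p w)"
    then obtain p r where "x = comb k p w" "y = comb k r w" by auto
    then show "x + y \<in> range (\<lambda>p. comb k p w)"
      by (intro range_eqI[of _ _ "\<lambda>i. p i + r i"])
         (simp add: comb_def scale_left_distrib sum.distrib)
  next
    fix c x assume "x \<in> range (\<lambda>p. comb k p w)"
    then obtain p where "x = comb k p w" by auto
    then show "c \<star> x \<in> range (\<lambda>p. comb k p w)"
      by (intro range_eqI[of _ _ "\<lambda>i. c * p i"])
         (simp add: comb_def scale_sum_right)
  qed
next
  fix T assume "w ` {..<k} \<subseteq> T" "subspace T"
  then show "range (\<lambda>p. comb k p w) \<subseteq> T"
    by (auto simp: comb_def intro!: subspace_sum subspace_scale)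
qed

lemma comb_Suc: "comb (Suc k) p w = p 0 \<star> w 0 + comb k (\<lambda>i. p (Suc i)) (\<lambda>i. w (Suc i))"
  unfolding comb_def by (rule sum.lessThan_Suc_shift)

text \<open>
  Adding to one generator a combination of the others is an elementary change of generators; these are
  the only changes needed below, apart from a transposition.
\<close>

lemma span_shear:
  assumes "j \<in> I" and u: "u \<in> span (w ` (I - {j}))"
  shows "span (w(j := w j + u) ` I) = span (w ` I)"
proof -
  let ?w = "w(j := w j + u)"
  have "?w ` (I - {j}) = w ` (I - {j})" by auto
  then have img: "?w ` I = insert (w j + u) (w ` (I - {j}))" "w ` I = insert (w j) (w ` (I - {j}))"
    using \<open>j \<in> I\<close> by (metis fun_upd_same image_insert insert_Diff)+
  show ?thesis
    unfolding img by (rule eq_span_insert_eq) (use u span_neg in simp)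
qed

text \<open>
  The structure theorem for finitely generated modules over a Euclidean ring, in terms of generators:
  after a change of generators \<open>w\<close>, the relations between them are exactly those that hold entry by
  entry. Among all families of \<open>k + 1\<close> generators of the span, all relations between them and all
  nonzero entries of these relations, take an entry \<open>c\<close> of least Euclidean size. Reducing another
  entry modulo \<open>c\<close> is the effect of a shear of the generators, so minimality forces \<open>c\<close> to divide its
  whole relation. Another shear then turns this relation into \<open>c \<star> w 0 = 0\<close>, and by minimality again
  \<open>c\<close> divides the first entry of every relation. Hence the multiples of \<open>w 0\<close> split off, and the
  remaining \<open>k\<close> generators are handled by induction. Without a nontrivial relation the generators are
  free, and all \<open>d i\<close> are 0.
\<close>

theorem diagonal_generators:
  "\<exists>w d. span (w ` {..<k}) = span (v ` {..<k}) \<and>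
         (\<forall>p. comb k p w = 0 \<longleftrightarrow> (\<forall>i<k. d i dvd p i)) \<and>
         (\<forall>i j. i \<le> j \<longrightarrow> j < k \<longrightarrow> d i dvd d j)"
proof (induction k arbitrary: v)
  case 0
  then show ?case by (auto simp: comb_def)
next
  case (Suc k)
  let ?I = "{..<Suc k}"
  define rel where "rel w p \<longleftrightarrow> span (w ` ?I) = span (v ` ?I) \<and> comb (Suc k) p w = 0" for w p
  define S where "S = {euclidean_size (p i) | w p i. rel w p \<and> i \<le> k \<and> p i \<noteq> 0}"
  show ?case
  proof (cases "S = {}")
    case True
    have "\<forall>i<Suc k. p i = 0" if "comb (Suc k) p v = 0" for p
      using that True by (auto simp: S_def rel_def)
    then show ?thesis
      by (intro exI[of _ v] exI[of _ "\<lambda>_. 0"]) (auto simp: comb_def)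
  next
    case False
    then have "(LEAST n. n \<in> S) \<in> S" by (meson LeastI ex_in_conv)
    then obtain w0 p0 i0 where 0: "rel w0 p0" "i0 \<le> k" "p0 i0 \<noteq> 0"
      "(LEAST n. n \<in> S) = euclidean_size (p0 i0)" by (auto simp: S_def)
    define c where "c = p0 i0"
    have c0: "c \<noteq> 0" using 0 by (simp add: c_def)
    have min: "r i = 0" if "rel w r" "i \<le> k" "euclidean_size (r i) < euclidean_size c" for w r i
    proof (rule ccontr)
      assume "r i \<noteq> 0"
      then have "euclidean_size (r i) \<in> S" using that by (auto simp: S_def)
      then show False using that(3) Least_le[of "\<lambda>n. n \<in> S"] 0 by (fastforce simp: c_def)
    qed
    \<comment> \<open>Transpose the indices so that the least entry comes first.\<close>
    define \<tau> where "\<tau> = Transposition.transpose 0 i0"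
    have \<tau>: "bij_betw \<tau> ?I ?I" 
      using 0 by (intro bij_betw_byWitness[where f' = \<tau>]) (auto simp: \<tau>_def transpose_def)
    define w where "w = w0 \<circ> \<tau>"
    define p where "p = p0 \<circ> \<tau>"
    have p_0: "p 0 = c" by (simp add: p_def \<tau>_def c_def)
    have "comb (Suc k) p w = comb (Suc k) p0 w0"
      unfolding comb_def p_def w_def comp_def by (rule sum.reindex_bij_betw[OF \<tau>])
    moreover have "w ` ?I = w0 ` ?I"
      using \<tau> unfolding w_def image_comp[symmetric] by (simp add: bij_betw_def)
    ultimately have rel: "rel w p" using 0 by (simp add: rel_def)
    \<comment> \<open>The quotient \<open>r i div c\<close> is shifted to the generator at 0, which leaves the remainder in place \<open>i\<close>.\<close>
    have dvd: "c dvd r i" if r: "rel x r" "r 0 = c" and i: "i \<le> k" for x r i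
    proof (cases "i = 0")
      case False
      define x' where "x' = x(0 := x 0 + (r i div c) \<star> x i)"
      define r' where "r' = r(i := r i mod c)"
      have "span (x' ` ?I) = span (x ` ?I)"
        unfolding x'_def using False i by (intro span_shear span_scale span_base) auto
      moreover have "comb (Suc k) r' x' = comb (Suc k) r x"
      proof -
        have split: "comb (Suc k) s y = s 0 \<star> y 0 + (s i \<star> y i + (\<Sum>j\<in>?I - {0} - {i}. s j \<star> y j))"
          for s y using False i by (simp add: comb_def sum.remove[of ?I 0] sum.remove[of "?I - {0}" i] del: sum.lessThan_Suc)
        have "(\<Sum>j\<in>?I - {0} - {i}. r' j \<star> x' j) = (\<Sum>j\<in>?I - {0} - {i}. r j \<star> x j)"
          by (intro sum.cong) (auto simp: r'_def x'_def)
        moreover have "r i \<star> x i = (c * (r i div c)) \<star> x i + (r i mod c) \<star> x i"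
          using scale_left_distrib[of "c * (r i div c)" "r i mod c" "x i"] by simp
        then have "r' 0 \<star> x' 0 + r' i \<star> x' i = r 0 \<star> x 0 + r i \<star> x i"
          using False r by (simp add: r'_def x'_def scale_right_distrib)
        ultimately show ?thesis unfolding split by (simp add: add.assoc[symmetric])
      qed
      ultimately have "rel x' r'" using r by (simp add: rel_def)
      from min[OF this i] have "r i mod c = 0" using c0 by (simp add: r'_def mod_size_less)
      then show ?thesis by auto
    qed (use r in simp)
    define u where "u = (\<Sum>i<k. (p (Suc i) div c) \<star> w (Suc i))"
    define w1 where "w1 = w(0 := w 0 + u)"
    have u: "u \<in> span (w ` (?I - {0}))"
      unfolding u_def by (intro span_sum span_scale span_base) auto
    have sp1: "span (w1 ` ?I) = span (v ` ?I)"
      unfolding w1_def using span_shear[OF _ u] rel by (simp add: rel_def)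
    have ann: "c \<star> w1 0 = 0"
    proof -
      have "c \<star> w1 0 = p 0 \<star> w 0 + (\<Sum>i<k. (c * (p (Suc i) div c)) \<star> w (Suc i))"
        by (simp add: w1_def u_def p_0 scale_right_distrib scale_sum_right)
      also have "(\<Sum>i<k. (c * (p (Suc i) div c)) \<star> w (Suc i)) = (\<Sum>i<k. p (Suc i) \<star> w (Suc i))"
        using dvd[OF rel p_0] by (intro sum.cong) (auto simp: Suc_le_eq)
      also have "p 0 \<star> w 0 + \<dots> = comb (Suc k) p w" by (simp add: comb_Suc) (simp add: comb_def)
      finally show ?thesis using rel by (simp add: rel_def)
    qed
    \<comment> \<open>The generator at 0 is killed by \<open>c\<close>, so the entry at 0 may be reduced modulo \<open>c\<close> for free.\<close>
    have dvd0: "c dvd r 0" if r: "comb (Suc k) r w1 = 0" for r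
    proof -
      define r' where "r' = r(0 := r 0 mod c)"
      have "r 0 \<star> w1 0 = (r 0 div c) \<star> (c \<star> w1 0) + (r 0 mod c) \<star> w1 0"
        using scale_left_distrib[of "r 0 div c * c" "r 0 mod c" "w1 0"] by simp
      then have "rel w1 r'" using r sp1 ann by (simp add: rel_def r'_def comb_Suc)
      from min[OF this] show ?thesis using c0 by (force simp: r'_def mod_size_less)
    qed
    obtain w2 d2 where IH1: "span (w2 ` {..<k}) = span ((\<lambda>i. w1 (Suc i)) ` {..<k})"
      and IH2: "\<forall>p. comb k p w2 = 0 \<longleftrightarrow> (\<forall>i<k. d2 i dvd p i)"
      and IH3: "\<forall>i j. i \<le> j \<longrightarrow> j < k \<longrightarrow> d2 i dvd d2 j"
      using Suc.IH[of "\<lambda>i. w1 (Suc i)"] by (elim exE conjE) (rule that)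
    define w3 where "w3 = case_nat (w1 0) w2"
    define d3 where "d3 = case_nat c d2"
    have img: "f ` ?I = insert (f 0) ((\<lambda>i. f (Suc i)) ` {..<k})" for f :: "nat \<Rightarrow> 'b"
      by (auto simp: image_iff lessThan_Suc_eq_insert_0)
    have sp3: "span (w3 ` ?I) = span (v ` ?I)"
    proof -
      have "span (w3 ` ?I) = span (insert (w1 0) (w2 ` {..<k}))" by (simp add: img w3_def)
      also have "\<dots> = span (insert (w1 0) ((\<lambda>i. w1 (Suc i)) ` {..<k}))"
        by (simp add: span_insert IH1)
      finally show ?thesis using sp1 by (simp add: img)
    qed
    have rel3: "comb (Suc k) r w3 = 0 \<longleftrightarrow> (\<forall>i<Suc k. d3 i dvd r i)" for r
    proof -
      have eq: "comb (Suc k) r w3 = r 0 \<star> w1 0 + comb k (\<lambda>i. r (Suc i)) w2"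
        by (simp add: comb_Suc w3_def)
      have "c dvd r 0" if "comb (Suc k) r w3 = 0"
      proof -
        have "comb k (\<lambda>i. r (Suc i)) w2 \<in> span ((\<lambda>i. w1 (Suc i)) ` {..<k})"
          using IH1 span_family[of w2 k] by blast
        then obtain s where "comb k (\<lambda>i. r (Suc i)) w2 = comb k s (\<lambda>i. w1 (Suc i))"
          unfolding span_family by blast
        then have "comb (Suc k) (case_nat (r 0) s) w1 = 0" using that eq by (simp add: comb_Suc)
        from dvd0[OF this] show ?thesis by simp
      qed
      moreover have "r 0 \<star> w1 0 = 0" if "c dvd r 0"
        using that ann by (auto simp: mult.commute[of c] scale_scale[symmetric] simp del: scale_scale)
      ultimately have "comb (Suc k) r w3 = 0 \<longleftrightarrow> c dvd r 0 \<and> comb k (\<lambda>i. r (Suc i)) w2 = 0"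
        using eq by auto
      also have "\<dots> \<longleftrightarrow> (\<forall>i<Suc k. d3 i dvd r i)"
        using IH2[rule_format, of "\<lambda>i. r (Suc i)"] by (auto simp: d3_def less_Suc_eq_0_disj)
      finally show ?thesis .
    qed
    \<comment> \<open>The entries of \<open>d3\<close> form a relation between the generators \<open>w3\<close>, and its first entry is \<open>c\<close>.\<close>
    have "c dvd d2 j" if "j < k" for j
    proof -
      have "rel w3 d3" using sp3 rel3 by (simp add: rel_def)
      from dvd[OF this, of "Suc j"] show ?thesis using that by (simp add: d3_def)
    qed
    then have "d3 i dvd d3 j" if "i \<le> j" "j < Suc k" for i j
      using that IH3 by (cases i; cases j) (auto simp: d3_def)
    then show ?thesis using sp3 rel3 by blast
  qed
qed

end

section \<open>Linear operators as polynomial modules\<close>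

declare sum.lessThan_Suc [simp del]

text \<open>
  An operator \<open>T\<close> on a vector space turns it into a module over the polynomial ring in which the
  indeterminate acts as \<open>T\<close>.
\<close>

locale linear_operator = Vector_Spaces.linear s s T
  for s :: "'a::field \<Rightarrow> 'b::ab_group_add \<Rightarrow> 'b" and T :: "'b \<Rightarrow> 'b"
begin

definition act :: "'a poly \<Rightarrow> 'b \<Rightarrow> 'b" where
  "act p v = fold_coeffs (\<lambda>a u. s a v + T u) p 0"

lemma act_0 [simp]: "act 0 v = 0"
  by (simp add: act_def)

lemma act_pCons: "act (pCons a p) v = s a v + T (act p v)"
  by (cases "p = 0 \<and> a = 0") (auto simp: act_def zero)

lemma act_add: "act (p + q) v = act p v + act q v"
  by (induction p q rule: poly_induct2) (simp_all add: act_pCons vs1.scale_left_distrib add)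

lemma act_smult: "act (smult c p) v = s c (act p v)"
  by (induction p) (simp_all add: act_pCons vs1.scale_right_distrib scale)

lemma act_add_right: "act p (u + v) = act p u + act p v"
  by (induction p) (simp_all add: act_pCons vs1.scale_right_distrib add)

lemma act_act: "act p (act q v) = act (p * q) v"
  by (induction p) (simp_all add: act_pCons act_add act_smult mult_pCons_left)

sublocale E: euclidean_module act
  by unfold_locales (simp_all add: act_add act_add_right act_act one_pCons act_pCons zero)

lemma act_const: "act [:c:] v = s c v"
  by (simp add: act_pCons zero)

lemma act_X: "act [:0, 1:] v = T v"
  by (simp add: act_pCons zero)

lemma act_closed:
  assumes "vs1.subspace V" "T ` V \<subseteq> V" "v \<in> V"
  shows "act p v \<in> V"
  using assms by (induction p)
    (auto simp: act_pCons vs1.subspace_0 intro!: vs1.subspace_add vs1.subspace_scale)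

lemma comb_add: "E.comb k p w + E.comb k r w = E.comb k (\<lambda>i. p i + r i) w"
  by (simp add: E.comb_def act_add sum.distrib)

lemma comb_diff: "E.comb k p w - E.comb k r w = E.comb k (\<lambda>i. p i - r i) w"
  by (simp add: E.comb_def E.scale_left_diff_distrib sum_subtractf)

lemma act_comb: "act a (E.comb k p w) = E.comb k (\<lambda>i. a * p i) w"
  by (simp add: E.comb_def E.scale_sum_right act_act)

text \<open>
  The subspace \<open>V\<close> is, as a module over the polynomials, the direct sum of the cyclic modules with
  annihilators \<open>ds ! i\<close>, where \<open>w i\<close> generates the \<open>i\<close>-th summand. An entry 1 contributes the
  zero module, so lists can be padded to any length.
\<close>

definition cyclic_gens :: "'b set \<Rightarrow> 'a poly list \<Rightarrow> (nat \<Rightarrow> 'b) \<Rightarrow> bool" where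
  "cyclic_gens V ds w \<longleftrightarrow> V = range (\<lambda>p. E.comb (length ds) p w) \<and>
     (\<forall>p. E.comb (length ds) p w = 0 \<longleftrightarrow> (\<forall>i<length ds. ds ! i dvd p i))"

definition cyclic_decomp :: "'b set \<Rightarrow> 'a poly list \<Rightarrow> bool" where
  "cyclic_decomp V ds \<longleftrightarrow> (\<exists>w. cyclic_gens V ds w)"

lemma cyclic_gens_eq_iff:
  assumes "cyclic_gens V ds w"
  shows "E.comb (length ds) p w = E.comb (length ds) r w \<longleftrightarrow> (\<forall>i<length ds. ds ! i dvd p i - r i)"
proof -
  have "E.comb (length ds) p w = E.comb (length ds) r w \<longleftrightarrow>
        E.comb (length ds) (\<lambda>i. p i - r i) w = 0"
    by (simp add: comb_diff[symmetric])
  then show ?thesis using assms by (simp add: cyclic_gens_def)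
qed

lemma cyclic_gens_in:
  assumes "cyclic_gens V ds w" "i < length ds"
  shows "w i \<in> V"
  using assms E.span_family[of w "length ds"] E.span_base[of "w i" "w ` {..<length ds}"]
  by (auto simp: cyclic_gens_def)

text \<open>
  In a direct sum of the modules of residues modulo \<open>ds ! i\<close> the kernel of multiplication by \<open>a\<close> is
  computed componentwise. For \<open>a = 0\<close> this is the coordinate description of all of \<open>V\<close>.
\<close>

lemma cyclic_gens_bij_residues:
  assumes gens: "cyclic_gens V ds w" and nz: "\<forall>d\<in>set ds. d \<noteq> 0"
  shows "bij_betw (\<lambda>r. E.comb (length ds) r w)
           (PiE {..<length ds} (\<lambda>i. {r. (r = 0 \<or> degree r < degree (ds ! i)) \<and> ds ! i dvd a * r}))
           {v \<in> V. act a v = 0}"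
    (is "bij_betw ?f (PiE ?I ?R) ?K")
proof (rule bij_betw_imageI)
  have V: "V = range (\<lambda>p. E.comb (length ds) p w)"
    and rel: "\<And>p. E.comb (length ds) p w = 0 \<longleftrightarrow> (\<forall>i<length ds. ds ! i dvd p i)"
    using gens by (auto simp: cyclic_gens_def)
  show "inj_on ?f (PiE ?I ?R)"
  proof (rule inj_onI)
    fix r r' assume r: "r \<in> PiE ?I ?R" "r' \<in> PiE ?I ?R" and eq: "?f r = ?f r'"
    show "r = r'"
    proof (rule PiE_ext[OF r])
      fix i assume i: "i \<in> ?I"
      have "ds ! i dvd r i - r' i"
        using eq i by (simp add: cyclic_gens_eq_iff[OF gens])
      moreover have "r i - r' i = 0 \<or> degree (r i - r' i) < degree (ds ! i)"
        using r i by (auto dest!: PiE_mem simp: degree_diff_less)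
      ultimately show "r i = r' i"
        using dvd_imp_degree_le[of "ds ! i" "r i - r' i"] by fastforce
    qed
  qed
  show "?f ` PiE ?I ?R = ?K"
  proof
    show "?f ` PiE ?I ?R \<subseteq> ?K"
    proof
      fix v assume "v \<in> ?f ` PiE ?I ?R"
      then obtain r where r: "r \<in> PiE ?I ?R" and v: "v = ?f r" by blast
      have "ds ! i dvd a * r i" if "i < length ds" for i
        using PiE_mem[OF r, of i] that by simp
      then show "v \<in> ?K" by (simp add: v V act_comb rel)
    qed
    show "?K \<subseteq> ?f ` PiE ?I ?R"
    proof
      fix v assume "v \<in> ?K"
      then obtain p where p: "v = E.comb (length ds) p w" and a: "act a v = 0" by (auto simp: V)
      define r where "r = restrict (\<lambda>i. p i mod ds ! i) ?I"
      have "ds ! i dvd p i - r i" if "i < length ds" for i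
        using that by (simp add: r_def minus_mod_eq_mult_div)
      then have v: "v = ?f r" by (simp add: p cyclic_gens_eq_iff[OF gens])
      moreover have "r \<in> PiE ?I ?R"
      proof (rule PiE_I)
        fix i assume i: "i \<in> ?I"
        then have "ds ! i \<noteq> 0" using nz by simp
        moreover have "ds ! i dvd a * r i"
          using a i by (simp add: v act_comb rel)
        ultimately show "r i \<in> ?R i"
          using degree_mod_less[of "ds ! i" "p i"] i by (auto simp: r_def)
      qed (simp add: r_def)
      ultimately show "v \<in> ?f ` PiE ?I ?R" by blast
    qed
  qed
qed

end

locale linear_operator_pair = A: linear_operator s T + B: linear_operator s' T'
  for s :: "'a::field \<Rightarrow> 'b::ab_group_add \<Rightarrow> 'b" and T
  and s' :: "'a \<Rightarrow> 'c::ab_group_add \<Rightarrow> 'c" and T'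
begin

text \<open>
  A module isomorphism, stated for maps that are meaningful on \<open>V\<close> only.
\<close>

definition intertwiner :: "'b set \<Rightarrow> 'c set \<Rightarrow> ('b \<Rightarrow> 'c) \<Rightarrow> bool" where
  "intertwiner V V' f \<longleftrightarrow> bij_betw f V V' \<and>
     (\<forall>u\<in>V. \<forall>v\<in>V. f (u + v) = f u + f v) \<and>
     (\<forall>c. \<forall>v\<in>V. f (s c v) = s' c (f v)) \<and>
     (\<forall>v\<in>V. f (T v) = T' (f v))"

text \<open>
  Generators with the same relations can be matched: sending each combination of the \<open>w i\<close> to the
  combination of the \<open>w' i\<close> with the same coefficients is well defined and injective because equality
  of combinations is in both cases expressed by divisibility by the \<open>ds ! i\<close>.
\<close>

lemma intertwiner_exists:
  assumes "A.cyclic_decomp V ds" "B.cyclic_decomp V' ds"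
  obtains f where "intertwiner V V' f"
proof -
  let ?n = "length ds"
  obtain w w' where w: "A.cyclic_gens V ds w" and w': "B.cyclic_gens V' ds w'"
    using assms by (auto simp: A.cyclic_decomp_def B.cyclic_decomp_def)
  define f where "f v = B.E.comb ?n (SOME p. A.E.comb ?n p w = v) w'" for v
  have f: "f (A.E.comb ?n p w) = B.E.comb ?n p w'" for p
  proof -
    have "A.E.comb ?n (SOME r. A.E.comb ?n r w = A.E.comb ?n p w) w = A.E.comb ?n p w"
      by (rule someI[of _ p]) (rule refl)
    then show ?thesis
      unfolding f_def B.cyclic_gens_eq_iff[OF w'] A.cyclic_gens_eq_iff[OF w] .
  qed
  have V: "V = range (\<lambda>p. A.E.comb ?n p w)" "V' = range (\<lambda>p. B.E.comb ?n p w')"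
    using w w' by (auto simp: A.cyclic_gens_def B.cyclic_gens_def)
  have act: "f (A.act a v) = B.act a (f v)" if "v \<in> V" for a v
    using that by (auto simp: V A.act_comb B.act_comb f)
  have "inj_on f V"
    by (auto simp: V inj_on_def f A.cyclic_gens_eq_iff[OF w] B.cyclic_gens_eq_iff[OF w'])
  moreover have "f ` V = V'"
    unfolding V image_image f ..
  moreover have "f (u + v) = f u + f v" if "u \<in> V" "v \<in> V" for u v
    using that by (auto simp: V A.comb_add B.comb_add f)
  ultimately have "intertwiner V V' f"
    using act[of _ "[:0, 1:]"] act[of _ "[:c:]" for c]
    by (auto simp: intertwiner_def bij_betw_def A.act_X B.act_X A.act_const B.act_const)
  then show ?thesis by (rule that)
qed

lemma cyclic_decomp_pullback:
  assumes f: "intertwiner V V' f" and V: "A.vs1.subspace V" "T ` V \<subseteq> V"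
    and dec: "B.cyclic_decomp V' ds"
  shows "A.cyclic_decomp V ds"
proof -
  let ?n = "length ds"
  obtain w' where w': "B.cyclic_gens V' ds w'"
    using dec by (auto simp: B.cyclic_decomp_def)
  have inj: "inj_on f V" and img: "f ` V = V'"
    and add: "\<And>u v. u \<in> V \<Longrightarrow> v \<in> V \<Longrightarrow> f (u + v) = f u + f v"
    and scl: "\<And>c v. v \<in> V \<Longrightarrow> f (s c v) = s' c (f v)"
    and int: "\<And>v. v \<in> V \<Longrightarrow> f (T v) = T' (f v)"
    using f by (auto simp: intertwiner_def bij_betw_def)
  have zero: "0 \<in> V" using V by (simp add: A.vs1.subspace_0)
  have f0: "f 0 = 0" using scl[OF zero, of 0] by simp
  have act: "f (A.act p v) = B.act p (f v)" if v: "v \<in> V" for p v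
  proof (induction p)
    case (pCons a p)
    have "A.act p v \<in> V" by (rule A.act_closed[OF V v])
    moreover have "T (A.act p v) \<in> V" "s a v \<in> V"
      using V v calculation by (auto intro: A.vs1.subspace_scale)
    ultimately show ?case using pCons v
      by (simp add: A.act_pCons B.act_pCons add scl int)
  qed (simp add: f0)
  define w where "w i = inv_into V f (w' i)" for i
  have w: "w i \<in> V" "f (w i) = w' i" if "i < ?n" for i
    using B.cyclic_gens_in[OF w' that] img by (auto simp: w_def inv_into_into f_inv_into_f)
  have comb_in: "A.E.comb k p w \<in> V" if "k \<le> ?n" for k p
    unfolding A.E.comb_def using that w(1) A.act_closed[OF V]
    by (intro A.vs1.subspace_sum[OF V(1)]) simp
  have f_comb: "f (A.E.comb ?n p w) = B.E.comb ?n p w'" for p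
  proof -
    have "f (A.E.comb k p w) = B.E.comb k p w'" if "k \<le> ?n" for k
      using that
    proof (induction k)
      case (Suc k)
      then show ?case
        using comb_in[of k p] w[of k] A.act_closed[OF V, of "w k" "p k"]
        by (simp add: A.E.comb_def B.E.comb_def sum.lessThan_Suc add act)
    qed (simp add: A.E.comb_def B.E.comb_def f0)
    then show ?thesis by simp
  qed
  have "V \<subseteq> range (\<lambda>p. A.E.comb ?n p w)"
  proof
    fix v assume v: "v \<in> V"
    then have "f v \<in> V'" using img by auto
    then obtain p where "f v = B.E.comb ?n p w'" using w' by (auto simp: B.cyclic_gens_def)
    then have "v = A.E.comb ?n p w"
      using v comb_in inj_onD[OF inj] by (simp add: f_comb)
    then show "v \<in> range (\<lambda>p. A.E.comb ?n p w)" by blast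
  qed
  moreover have "A.E.comb ?n p w = 0 \<longleftrightarrow> B.E.comb ?n p w' = 0" for p
    using inj_on_eq_iff[OF inj comb_in[OF order_refl] zero] by (simp add: f_comb f0)
  ultimately have "A.cyclic_gens V ds w"
    using w' comb_in[OF order_refl] by (auto simp: A.cyclic_gens_def B.cyclic_gens_def)
  then show ?thesis by (auto simp: A.cyclic_decomp_def)
qed

end

section \<open>Invariant factors are determined by kernel sizes\<close>

lemma one_less_card_field: "1 < CARD('a::{field, finite})"
proof -
  have "card {0, 1 :: 'a} \<le> CARD('a)" by (rule card_mono) auto
  then show ?thesis by simp
qed

text \<open>
  The kernel of multiplication by \<open>a\<close> on the residues modulo \<open>d\<close>. Its size is at most that of the
  full set of residues \<open>res_ker 0 d\<close>, and for nonzero \<open>d\<close> equality means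
  that \<open>d\<close> divides \<open>a\<close>; this detects the divisors in a decomposition.
\<close>

definition res_ker :: "'a::field poly \<Rightarrow> 'a poly \<Rightarrow> 'a poly set" where
  "res_ker a d = {r. (r = 0 \<or> degree r < degree d) \<and> d dvd a * r}"

text \<open>
  The standard vector space of dimension \<open>n\<close>, realised inside one type for all \<open>n\<close>. The vectors
  for varying \<open>n\<close> thus share a type that is an abelian group under pointwise addition.
\<close>

definition supported :: "nat \<Rightarrow> (nat \<Rightarrow> 'a::zero) set" where
  "supported n = {f. \<forall>i\<ge>n. f i = 0}"

lemma card_supported: "card (supported n :: (nat \<Rightarrow> 'a::{zero, finite}) set) = CARD('a) ^ n"
  and finite_supported: "finite (supported n :: (nat \<Rightarrow> 'a::{zero, finite}) set)"
proof -
  let ?E = "{..<n} \<rightarrow>\<^sub>E (UNIV :: 'a set)"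
  have "bij_betw (\<lambda>f. restrict f {..<n}) (supported n) ?E"
    by (rule bij_betw_byWitness[where f' = "\<lambda>f i. if i < n then f i else 0"])
       (auto simp: supported_def fun_eq_iff PiE_def extensional_def)
  moreover have "finite ?E" by (rule finite_PiE) auto
  ultimately show "card (supported n :: (nat \<Rightarrow> 'a) set) = CARD('a) ^ n"
    "finite (supported n :: (nat \<Rightarrow> 'a) set)"
    by (simp_all add: bij_betw_same_card card_PiE bij_betw_finite)
qed

lemma card_res_ker_0: "card (res_ker 0 d) = CARD('a) ^ degree d"
  and finite_res_ker: "finite (res_ker a d)"
  for d :: "'a::{field, finite} poly"
proof -
  let ?R = "{r :: 'a poly. r = 0 \<or> degree r < degree d}"
  have *: "r \<in> ?R \<longleftrightarrow> coeff r \<in> supported (degree d)" for r :: "'a poly"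
  proof
    assume "coeff r \<in> supported (degree d)"
    then show "r \<in> ?R"
      by (metis (mono_tags, lifting) leading_coeff_0_iff linorder_not_less mem_Collect_eq supported_def)
  qed (auto simp: supported_def coeff_eq_0)
  have "f \<in> coeff ` ?R" if "f \<in> supported (degree d)" for f :: "nat \<Rightarrow> 'a"
  proof -
    have eq: "coeff (Poly (map f [0..<degree d])) = f"
      using that by (auto simp: fun_eq_iff coeff_Poly_eq nth_default_def supported_def)
    have "Poly (map f [0..<degree d]) \<in> ?R"
      unfolding * eq by (rule that)
    then show ?thesis using eq by (intro image_eqI) auto
  qed
  then have img: "coeff ` ?R = supported (degree d)" using * by blast
  have inj: "inj_on coeff ?R" by (auto simp: inj_on_def poly_eq_iff)
  have fin: "finite ?R"
    using inj by (rule finite_imageD[rotated]) (simp add: img finite_supported)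
  then show "finite (res_ker a d)"
    by (rule finite_subset[rotated]) (auto simp: res_ker_def)
  have "card ?R = CARD('a) ^ degree d"
    using card_image[OF inj] by (simp add: img card_supported)
  then show "card (res_ker 0 d) = CARD('a) ^ degree d"
    by (simp add: res_ker_def)
qed

lemma card_res_ker_pos: "0 < card (res_ker a (d :: 'a::{field, finite} poly))"
  using finite_res_ker[of a d] by (auto simp: card_gt_0_iff res_ker_def)

lemma card_res_ker_le: "card (res_ker a d) \<le> card (res_ker 0 (d :: 'a::{field, finite} poly))"
  by (rule card_mono[OF finite_res_ker]) (auto simp: res_ker_def)

lemma card_res_ker_eq_iff:
  fixes d :: "'a::{field, finite} poly"
  assumes "d \<noteq> 0"
  shows "card (res_ker a d) = card (res_ker 0 d) \<longleftrightarrow> d dvd a"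
proof
  assume eq: "card (res_ker a d) = card (res_ker 0 d)"
  have "res_ker a d = res_ker 0 d"
    by (rule card_subset_eq[OF finite_res_ker _ eq]) (auto simp: res_ker_def)
  \<comment> \<open>The residue of 1 is killed by \<open>a\<close> only if \<open>d\<close> divides \<open>a\<close>.\<close>
  moreover have "1 \<in> res_ker 0 d" if "degree d > 0" using that by (simp add: res_ker_def)
  ultimately have "degree d > 0 \<Longrightarrow> 1 \<in> res_ker a d" by blast
  then have "degree d > 0 \<Longrightarrow> d dvd a" by (simp add: res_ker_def)
  moreover have "degree d = 0 \<Longrightarrow> d dvd a"
    using assms is_unit_iff_degree unit_imp_dvd by blast
  ultimately show "d dvd a" by blast
qed (simp add: res_ker_def)

lemma prod_list_eq_pointwise:
  fixes f g :: "'b \<Rightarrow> nat"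
  assumes "prod_list (map f xs) = prod_list (map g xs)"
    and "\<And>x. x \<in> set xs \<Longrightarrow> 0 < f x \<and> f x \<le> g x"
  shows "\<forall>x\<in>set xs. f x = g x"
  using assms
proof (induction xs)
  case (Cons x xs)
  have le: "prod_list (map f ys) \<le> prod_list (map g ys)" "0 < prod_list (map f ys)"
    if "set ys \<subseteq> set (x # xs)" for ys
    using that Cons.prems(2) by (induction ys) (auto simp: mult_le_mono)
  have x: "0 < f x" "f x \<le> g x" using Cons.prems(2)[of x] by simp_all
  have eq: "f x * prod_list (map f xs) = g x * prod_list (map g xs)"
    using Cons.prems(1) by simp
  have "f x = g x"
  proof (rule ccontr)
    assume "f x \<noteq> g x"
    then have "f x * prod_list (map f xs) < g x * prod_list (map f xs)"
      using x le(2)[of xs] by auto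
    also have "\<dots> \<le> g x * prod_list (map g xs)"
      using le(1)[of xs] by auto
    finally show False using eq by simp
  qed
  then show ?case using Cons eq x by auto
qed simp

definition monic_chain :: "'a::field poly list \<Rightarrow> bool" where
  "monic_chain ds \<longleftrightarrow> sorted_wrt (dvd) ds \<and> (\<forall>d\<in>set ds. lead_coeff d = 1)"

lemma monic_dvd_antisym:
  fixes d e :: "'a::field poly"
  assumes "lead_coeff d = 1" "lead_coeff e = 1" "d dvd e" "e dvd d"
  shows "d = e"
proof -
  obtain k where k: "e = d * k" using assms by auto
  have nz: "d \<noteq> 0" "e \<noteq> 0" using assms by auto
  have "degree d = degree e" using assms nz by (simp add: dvd_imp_degree_le antisym)
  then have "degree k = 0" using k nz by (auto simp: degree_mult_eq)
  moreover have "lead_coeff k = 1" using assms k by (simp add: lead_coeff_mult)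
  ultimately have "k = 1" by (metis degree_eq_zeroE lead_coeff_pCons(2) pCons_0_0 one_pCons coeff_pCons_0 )
  then show ?thesis using k by simp
qed

text \<open>
  The numbers of elements killed by the various polynomials \<open>a\<close> determine the invariant factors. The
  product over a list is maximal at \<open>a\<close> iff each of its entries divides \<open>a\<close>. For a chain the last
  entry is such an \<open>a\<close>, hence the last entries of the two chains divide each other and agree; their
  positive contribution cancels, and induction does the rest.
\<close>

lemma monic_chain_unique:
  fixes ds es :: "'a::{field, finite} poly list"
  assumes "length ds = length es" "monic_chain ds" "monic_chain es"
    and "\<And>a. prod_list (map (\<lambda>d. card (res_ker a d)) ds) = prod_list (map (\<lambda>d. card (res_ker a d)) es)"
  shows "ds = es"
  using assms
proof (induction ds arbitrary: es rule: rev_induct)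
  case (snoc d ds)
  then obtain es' e where es: "es = es' @ [e]" and len: "length ds = length es'"
    by (metis length_append_singleton length_Suc_conv_rev)
  have ch: "monic_chain ds" "monic_chain es'"
    "\<forall>x\<in>set (ds @ [d]). x dvd d \<and> x \<noteq> 0" "\<forall>x\<in>set (es' @ [e]). x dvd e \<and> x \<noteq> 0"
    "lead_coeff d = 1" "lead_coeff e = 1"
    using snoc.prems(2,3) by (auto simp: monic_chain_def es sorted_wrt_append)
  \<comment> \<open>Maximality at \<open>x\<close> passes from \<open>xs\<close> to \<open>ys\<close>; it is expressed by equality with the value at 0.\<close>
  have dvd: "y dvd x"
    if x: "\<forall>z\<in>set xs. z dvd x \<and> z \<noteq> 0" and y: "\<forall>z\<in>set ys. z \<noteq> 0" "y \<in> set ys"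
      and eq: "\<And>a. prod_list (map (\<lambda>d. card (res_ker a d)) xs) =
                   prod_list (map (\<lambda>d. card (res_ker a d)) ys)"
    for x y :: "'a poly" and xs ys
  proof -
    have "prod_list (map (\<lambda>d. card (res_ker x d)) xs) = prod_list (map (\<lambda>d. card (res_ker 0 d)) xs)"
      using x by (intro arg_cong[of _ _ prod_list] map_cong) (auto simp: card_res_ker_eq_iff)
    then have "prod_list (map (\<lambda>d. card (res_ker x d)) ys) = prod_list (map (\<lambda>d. card (res_ker 0 d)) ys)"
      by (simp add: eq)
    from prod_list_eq_pointwise[OF this] show ?thesis
      using y by (auto simp: card_res_ker_pos card_res_ker_le card_res_ker_eq_iff)
  qed
  have "e dvd d"
    by (rule dvd[of "ds @ [d]" d "es' @ [e]" e]) (use ch snoc.prems(4) es in auto)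
  moreover have "d dvd e"
    by (rule dvd[of "es' @ [e]" e "ds @ [d]" d]) (use ch snoc.prems(4) es in auto)
  ultimately have de: "d = e" using ch monic_dvd_antisym by blast
  have "ds = es'"
  proof (rule snoc.IH[OF len ch(1,2)])
    fix a
    show "prod_list (map (\<lambda>d. card (res_ker a d)) ds) = prod_list (map (\<lambda>d. card (res_ker a d)) es')"
      using snoc.prems(4)[of a] card_res_ker_pos[of a e] by (simp add: es de)
  qed
  then show ?case using de es by simp
qed simp

lemma card_kernel_cyclic_decomp:
  fixes s :: "'a::{field, finite} \<Rightarrow> 'b::ab_group_add \<Rightarrow> 'b"
  assumes "linear_operator s T" "linear_operator.cyclic_decomp s T V ds" "\<forall>d\<in>set ds. d \<noteq> 0"
  shows "card {v \<in> V. linear_operator.act s T a v = 0} = prod_list (map (\<lambda>d. card (res_ker a d)) ds)"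
proof -
  interpret linear_operator s T by fact
  obtain w where w: "cyclic_gens V ds w" using assms(2) by (auto simp: cyclic_decomp_def)
  have "card {v \<in> V. act a v = 0} = (\<Prod>i<length ds. card (res_ker a (ds ! i)))"
    using bij_betw_same_card[OF cyclic_gens_bij_residues[OF w assms(3), of a]]
    by (simp add: card_PiE res_ker_def)
  then show ?thesis by (simp add: prod.list_conv_set_nth atLeast0LessThan)
qed

lemma card_cyclic_decomp:
  fixes s :: "'a::{field, finite} \<Rightarrow> 'b::ab_group_add \<Rightarrow> 'b"
  assumes "linear_operator s T" "linear_operator.cyclic_decomp s T V ds" "\<forall>d\<in>set ds. d \<noteq> 0"
  shows "card V = CARD('a) ^ sum_list (map degree ds)"
proof -
  interpret linear_operator s T by fact
  have "card V = prod_list (map (\<lambda>d. card (res_ker 0 d)) ds)"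
    using card_kernel_cyclic_decomp[OF assms, of 0] by simp
  also have "\<dots> = prod_list (map (\<lambda>d. CARD('a) ^ degree d) ds)"
    by (simp add: card_res_ker_0)
  also have "\<dots> = CARD('a) ^ sum_list (map degree ds)"
    by (induction ds) (auto simp: power_add)
  finally show ?thesis .
qed

section \<open>Conjugacy of matrices as isomorphism of modules\<close>

definition fscale :: "'a::field \<Rightarrow> (nat \<Rightarrow> 'a) \<Rightarrow> nat \<Rightarrow> 'a" where
  "fscale c f = (\<lambda>i. c * f i)"

definition mat_op :: "nat \<Rightarrow> 'a::field mat \<Rightarrow> (nat \<Rightarrow> 'a) \<Rightarrow> nat \<Rightarrow> 'a" where
  "mat_op n A f = (\<lambda>i. if i < n then \<Sum>j<n. A $$ (i, j) * f j else 0)"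

lemma vector_space_fscale: "Vector_Spaces.vector_space (fscale :: 'a::field \<Rightarrow> _)"
  by unfold_locales (auto simp: fscale_def fun_eq_iff algebra_simps)

lemma linear_operator_mat_op: "linear_operator fscale (mat_op n A)"
proof -
  interpret Vector_Spaces.vector_space "fscale :: 'a \<Rightarrow> _" by (rule vector_space_fscale)
  show ?thesis
    by unfold_locales
       (auto simp: mat_op_def fscale_def fun_eq_iff algebra_simps sum.distrib sum_distrib_left)
qed

interpretation mat_op: linear_operator fscale "mat_op n A" for n and A :: "'a::field mat"
  by (rule linear_operator_mat_op)

lemma subspace_supported: "Modules.module.subspace fscale (supported n :: (nat \<Rightarrow> 'a::field) set)"
  by (rule mat_op.vs1.subspaceI) (auto simp: supported_def fscale_def)

lemma mat_op_closed: "mat_op n A f \<in> supported n"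
  by (simp add: mat_op_def supported_def)

lemma mat_op_mult:
  assumes "A \<in> carrier_mat n n" "B \<in> carrier_mat n n"
  shows "mat_op n (A * B) f = mat_op n A (mat_op n B f)"
proof
  fix i
  have "(\<Sum>j<n. (A * B) $$ (i, j) * f j) = (\<Sum>j<n. A $$ (i, j) * mat_op n B f j)" if i: "i < n"
  proof -
    have "(\<Sum>j<n. (A * B) $$ (i, j) * f j) = (\<Sum>j<n. \<Sum>k<n. A $$ (i, k) * B $$ (k, j) * f j)"
      using assms i by (intro sum.cong)
        (auto simp: scalar_prod_def sum_distrib_right atLeast0LessThan intro!: sum.cong)
    also have "\<dots> = (\<Sum>k<n. \<Sum>j<n. A $$ (i, k) * B $$ (k, j) * f j)" by (rule sum.swap)
    also have "\<dots> = (\<Sum>k<n. A $$ (i, k) * mat_op n B f k)"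
      by (intro sum.cong) (auto simp: mat_op_def sum_distrib_left mult.assoc)
    finally show ?thesis .
  qed
  then show "mat_op n (A * B) f i = mat_op n A (mat_op n B f) i" by (simp add: mat_op_def[of n A] mat_op_def[of n "A * B"])
qed

lemma mat_op_one: "f \<in> supported n \<Longrightarrow> mat_op n (1\<^sub>m n) f = f"
  by (auto simp: mat_op_def supported_def fun_eq_iff if_distrib[of "\<lambda>x. x * _"] cong: if_cong)

lemma mat_op_eqD:
  assumes "A \<in> carrier_mat n n" "B \<in> carrier_mat n n"
    and "\<And>f. f \<in> supported n \<Longrightarrow> mat_op n A f = mat_op n B f"
  shows "A = B"
proof (rule eq_matI)
  fix i j assume ij: "i < dim_row B" "j < dim_col B"
  have "mat_op n C (\<lambda>k. if k = j then 1 else 0) i = C $$ (i, j)" for C :: "'a mat"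
    using ij assms(2) by (simp add: mat_op_def if_distrib[of "\<lambda>x. _ * x"] cong: if_cong)
  then show "A $$ (i, j) = B $$ (i, j)"
    using fun_cong[OF assms(3)[of "\<lambda>k. if k = j then 1 else 0"], of i] ij assms(2)
    by (auto simp: supported_def)
qed (use assms in auto)

lemma linear_eq_mat_op:
  fixes L :: "(nat \<Rightarrow> 'a::field) \<Rightarrow> nat \<Rightarrow> 'a"
  assumes L: "L ` supported n \<subseteq> supported n"
    and add: "\<And>f g. f \<in> supported n \<Longrightarrow> g \<in> supported n \<Longrightarrow> L (f + g) = L f + L g"
    and scl: "\<And>c f. f \<in> supported n \<Longrightarrow> L (fscale c f) = fscale c (L f)"
  obtains A where "A \<in> carrier_mat n n" "\<And>f. f \<in> supported n \<Longrightarrow> mat_op n A f = L f"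
proof -
  define e :: "nat \<Rightarrow> nat \<Rightarrow> 'a" where "e j = (\<lambda>k. if k = j then 1 else 0)" for j
  define A where "A = Matrix.mat n n (\<lambda>(i, j). L (e j) i)"
  have e: "e j \<in> supported n" if "j < n" for j using that by (auto simp: e_def supported_def)
  have "mat_op n A f = L f" if f: "f \<in> supported n" for f
  proof -
    \<comment> \<open>Additivity extends to the expansion of \<open>f\<close> in unit vectors by adding one coordinate at a time.\<close>
    define trunc where "trunc m = (\<lambda>i. if i < m then f i else 0)" for m
    have "L (trunc m) = (\<lambda>i. \<Sum>j<m. L (e j) i * f j)" if "m \<le> n" for m
      using that
    proof (induction m)
      case 0
      have "0 \<in> supported n" by (simp add: supported_def)
      from scl[OF this, of 0] show ?case
        by (simp add: trunc_def fscale_def zero_fun_def)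
    next
      case (Suc m)
      have "trunc (Suc m) = trunc m + fscale (f m) (e m)"
        by (auto simp: trunc_def fscale_def e_def fun_eq_iff less_Suc_eq)
      moreover have "trunc m \<in> supported n" "fscale (f m) (e m) \<in> supported n"
        using Suc.prems by (auto simp: trunc_def supported_def fscale_def e_def)
      ultimately have "L (trunc (Suc m)) = L (trunc m) + fscale (f m) (L (e m))"
        using Suc.prems by (simp add: add scl e)
      then show ?case using Suc by (simp add: fun_eq_iff fscale_def sum.lessThan_Suc)
    qed
    moreover have "L (e j) i = 0" if "j < n" "i \<ge> n" for i j
    proof -
      have "L (e j) \<in> supported n" using L e[OF that(1)] by blast
      then show ?thesis using that(2) by (simp add: supported_def)
    qed
    ultimately have "L (trunc n) = mat_op n A f"
      by (simp add: mat_op_def A_def fun_eq_iff)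
    moreover have "trunc n = f" using f by (auto simp: trunc_def supported_def fun_eq_iff)
    ultimately show ?thesis by simp
  qed
  then show ?thesis using that[of A] by (simp add: A_def)
qed

lemma GL_carrier:
  "P \<in> carrier (GL TYPE('a::field) n) \<longleftrightarrow>
   P \<in> carrier_mat n n \<and> (\<exists>Q\<in>carrier_mat n n. Q * P = 1\<^sub>m n \<and> P * Q = 1\<^sub>m n)"
  by (auto simp: GL_def units_of_def Units_def ring_mat_simps)

lemma GL_inv:
  assumes P: "P \<in> carrier (GL TYPE('a::field) n)"
  defines "P' \<equiv> inv\<^bsub>GL TYPE('a) n\<^esub> P"
  shows "P' \<in> carrier_mat n n" "P' * P = 1\<^sub>m n" "P * P' = 1\<^sub>m n"
proof -
  interpret R: ring "ring_mat TYPE('a) n ()" by (rule ring_mat)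
  interpret G: group "GL TYPE('a) n" unfolding GL_def by (rule R.units_group)
  show "P' \<in> carrier_mat n n"
    using G.inv_closed[OF P] by (simp add: P'_def GL_carrier)
  show "P' * P = 1\<^sub>m n" "P * P' = 1\<^sub>m n"
    using G.l_inv[OF P] G.r_inv[OF P] by (simp_all add: P'_def GL_def units_of_def ring_mat_simps)
qed

abbreviation mat_intertwiner :: "nat \<Rightarrow> 'a::field mat \<Rightarrow> 'a mat \<Rightarrow> ((nat \<Rightarrow> 'a) \<Rightarrow> nat \<Rightarrow> 'a) \<Rightarrow> bool" where
  "mat_intertwiner n A B \<equiv>
     linear_operator_pair.intertwiner fscale (mat_op n A) fscale (mat_op n B) (supported n) (supported n)"

lemma linear_operator_pair_mat_op:
  "linear_operator_pair fscale (mat_op n A) fscale (mat_op m B)"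
  by (simp add: linear_operator_pair_def linear_operator_mat_op)

text \<open>
  Conjugacy is isomorphism of the modules given by the two matrices: a conjugating matrix is the same
  as an invertible operator that commutes with the actions, because every linear map on
  \<open>supported n\<close> is given by a matrix.
\<close>

lemma orbit_iff_intertwiner:
  assumes A: "A \<in> carrier_mat n n" and B: "B \<in> carrier_mat n n"
  shows "B \<in> orbit (GL TYPE('a::field) n) (mat_conj n) A \<longleftrightarrow> (\<exists>f. mat_intertwiner n A B f)"
proof
  interpret pair: linear_operator_pair fscale "mat_op n A" fscale "mat_op n B"
    by (rule linear_operator_pair_mat_op)
  assume "B \<in> orbit (GL TYPE('a) n) (mat_conj n) A"
  then obtain P where P: "P \<in> carrier (GL TYPE('a) n)" and B_eq: "B = mat_conj n P A"
    by (auto simp: orbit_def)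
  define Q where "Q = inv\<^bsub>GL TYPE('a) n\<^esub> P"
  have PQ: "P \<in> carrier_mat n n" "Q \<in> carrier_mat n n" "Q * P = 1\<^sub>m n" "P * Q = 1\<^sub>m n"
    using P GL_inv[OF P] by (auto simp: Q_def GL_carrier)
  have "B * P = P * A * (Q * P)"
    using A PQ(1,2) by (simp add: B_eq mat_conj_def Q_def[symmetric] assoc_mult_mat[of _ n n _ n _ n])
  also have "\<dots> = P * A" using A PQ by simp
  finally have BP: "B * P = P * A" .
  have "bij_betw (mat_op n P) (supported n) (supported n)"
    by (rule bij_betw_byWitness[where f' = "mat_op n Q"])
       (auto simp: mat_op_mult[symmetric] PQ mat_op_one mat_op_closed)
  then have "mat_intertwiner n A B (mat_op n P)"
    by (auto simp: pair.intertwiner_def mat_op.add mat_op.scale mat_op_mult[symmetric] A B PQ BP)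
  then show "\<exists>f. mat_intertwiner n A B f" by blast
next
  interpret pair: linear_operator_pair fscale "mat_op n A" fscale "mat_op n B"
    by (rule linear_operator_pair_mat_op)
  let ?V = "supported n :: (nat \<Rightarrow> 'a) set"
  assume "\<exists>f. mat_intertwiner n A B f"
  then obtain f where bij: "bij_betw f ?V ?V"
    and add: "\<And>u v. u \<in> ?V \<Longrightarrow> v \<in> ?V \<Longrightarrow> f (u + v) = f u + f v"
    and scl: "\<And>c v. v \<in> ?V \<Longrightarrow> f (fscale c v) = fscale c (f v)"
    and int: "\<And>v. v \<in> ?V \<Longrightarrow> f (mat_op n A v) = mat_op n B (f v)"
    by (auto simp: pair.intertwiner_def)
  note sub = mat_op.vs1.subspace_add[OF subspace_supported] mat_op.vs1.subspace_scale[OF subspace_supported]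
  define g where "g = inv_into ?V f"
  have gV: "g v \<in> ?V" and fg: "f (g v) = v" if "v \<in> ?V" for v
    using that bij by (auto simp: g_def bij_betw_def inv_into_into f_inv_into_f)
  have gf: "g (f v) = v" and fV: "f v \<in> ?V" if "v \<in> ?V" for v
    using that bij by (auto simp: g_def bij_betw_def)
  obtain P where P: "P \<in> carrier_mat n n" "\<And>v. v \<in> ?V \<Longrightarrow> mat_op n P v = f v"
    using linear_eq_mat_op[of f n] fV add scl by blast
  have "g (u + v) = g u + g v" if "u \<in> ?V" "v \<in> ?V" for u v
    using that by (metis add fg gV gf sub(1))
  moreover have "g (fscale c v) = fscale c (g v)" if "v \<in> ?V" for c v
    using that by (metis scl fg gV gf sub(2))
  ultimately obtain Q where Q: "Q \<in> carrier_mat n n" "\<And>v. v \<in> ?V \<Longrightarrow> mat_op n Q v = g v"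
    using linear_eq_mat_op[of g n] gV by blast
  have QP: "Q * P = 1\<^sub>m n"
    by (rule mat_op_eqD) (use P Q gf fV in \<open>auto simp: mat_op_mult mat_op_one\<close>)
  have PQ: "P * Q = 1\<^sub>m n"
    by (rule mat_op_eqD) (use P Q fg gV in \<open>auto simp: mat_op_mult mat_op_one\<close>)
  have PA: "P * A = B * P"
    by (rule mat_op_eqD) (use P A B int in \<open>auto simp: mat_op_mult mat_op_closed\<close>)
  have GL: "P \<in> carrier (GL TYPE('a) n)"
    using P Q PQ QP by (auto simp: GL_carrier)
  note inv = GL_inv[OF GL]
  have "mat_conj n P A = B * P * inv\<^bsub>GL TYPE('a) n\<^esub> P"
    using A by (simp add: mat_conj_def PA)
  also have "\<dots> = B" using B P inv by (simp add: assoc_mult_mat[of _ n n _ n _ n])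
  finally show "B \<in> orbit (GL TYPE('a) n) (mat_conj n) A"
    using GL by (auto simp: orbit_def)
qed

section \<open>Invariant factors of a matrix\<close>

abbreviation mat_type :: "nat \<Rightarrow> 'a::field mat \<Rightarrow> 'a poly list \<Rightarrow> bool" where
  "mat_type n A ds \<equiv> linear_operator.cyclic_decomp fscale (mat_op n A) (supported n) ds"

lemma mat_op_image: "mat_op n A ` supported n \<subseteq> supported n"
  using mat_op_closed by blast

text \<open>
  Conjugate matrices have the same decompositions, since these can be pulled back along an isomorphism;
  conversely a common decomposition provides an isomorphism.
\<close>

lemma orbit_of_mat_type:
  assumes A: "A \<in> carrier_mat n n" and ds: "mat_type n A ds"
  shows "orbit (GL TYPE('a::field) n) (mat_conj n) A = {B \<in> carrier_mat n n. mat_type n B ds}"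
proof (intro subset_antisym subsetI)
  interpret group_action "GL TYPE('a) n" "carrier_mat n n" "mat_conj n"
    by (rule group_action_mat_conj)
  fix B assume orb: "B \<in> orbit (GL TYPE('a) n) (mat_conj n) A"
  then have B: "B \<in> carrier_mat n n" using A element_image by (auto simp: orbit_def)
  then have "A \<in> orbit (GL TYPE('a) n) (mat_conj n) B" using A orb orbit_sym by blast
  then obtain f where "mat_intertwiner n B A f"
    using orbit_iff_intertwiner[OF B A] by blast
  then have "mat_type n B ds"
    using linear_operator_pair.cyclic_decomp_pullback[OF linear_operator_pair_mat_op]
      subspace_supported mat_op_image ds by blast
  with B show "B \<in> {B \<in> carrier_mat n n. mat_type n B ds}" by simp
next
  fix B assume "B \<in> {B \<in> carrier_mat n n. mat_type n B ds}"
  then have B: "B \<in> carrier_mat n n" "mat_type n B ds" by auto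
  obtain f where "mat_intertwiner n A B f"
    using linear_operator_pair.intertwiner_exists[OF linear_operator_pair_mat_op ds B(2)] by blast
  then show "B \<in> orbit (GL TYPE('a) n) (mat_conj n) A"
    using orbit_iff_intertwiner[OF A B(1)] by blast
qed

lemma mat_type_unique:
  fixes A :: "'a::{field, finite} mat"
  assumes "mat_type n A ds" "mat_type n A es" "monic_chain ds" "monic_chain es" "length ds = length es"
  shows "ds = es"
proof (rule monic_chain_unique)
  fix a
  have "\<forall>d\<in>set ds. d \<noteq> 0" "\<forall>d\<in>set es. d \<noteq> 0"
    using assms(3,4) by (auto simp: monic_chain_def)
  then show "prod_list (map (\<lambda>d. card (res_ker a d)) ds) = prod_list (map (\<lambda>d. card (res_ker a d)) es)"
    using card_kernel_cyclic_decomp[OF linear_operator_mat_op assms(1), of a]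
      card_kernel_cyclic_decomp[OF linear_operator_mat_op assms(2), of a] by simp
qed (use assms in auto)

lemma sum_degree_mat_type:
  fixes A :: "'a::{field, finite} mat"
  assumes "mat_type n A ds" "\<forall>d\<in>set ds. d \<noteq> 0"
  shows "sum_list (map degree ds) = n"
proof -
  have "CARD('a) ^ n = CARD('a) ^ sum_list (map degree ds)"
    using card_cyclic_decomp[OF linear_operator_mat_op assms] by (simp add: card_supported)
  then show ?thesis using one_less_card_field[where 'a = 'a] by simp
qed

lemma infinite_UNIV_poly: "infinite (UNIV :: 'a::field poly set)"
proof
  assume fin: "finite (UNIV :: 'a poly set)"
  have "inj (\<lambda>n. monom (1 :: 'a) n)" by (auto simp: inj_def monom_eq_iff')
  then have "finite (UNIV :: nat set)" using fin finite_imageD[of "\<lambda>n. monom (1 :: 'a) n" UNIV]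
    by (meson finite_subset top_greatest)
  then show False by simp
qed

text \<open>
  There are infinitely many polynomials but only finitely many vectors, so two polynomials act equally
  on a given vector.
\<close>

lemma torsion:
  fixes A :: "'a::{field, finite} mat"
  assumes v: "v \<in> supported n"
  obtains p where "p \<noteq> 0" "mat_op.act n A p v = 0"
proof -
  have "range (\<lambda>p. mat_op.act n A p v) \<subseteq> supported n"
    using mat_op.act_closed[OF subspace_supported mat_op_image v] by blast
  then have "finite (range (\<lambda>p. mat_op.act n A p v))"
    using finite_supported finite_subset by blast
  then have "\<not> inj (\<lambda>p. mat_op.act n A p v)"
    using infinite_UNIV_poly finite_imageD by blast
  then obtain p r where "p \<noteq> r" "mat_op.act n A p v = mat_op.act n A r v"
    by (auto simp: inj_def)
  then show ?thesis
    using that[of "p - r"] by (simp add: mat_op.E.scale_left_diff_distrib)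
qed

text \<open>
  The \<open>n\<close> unit vectors, padded by zeros, are \<open>N\<close> generators. The structure theorem yields annihilators
  that are nonzero by torsion, hence can be made monic, and counting vectors gives the sum of their
  degrees.
\<close>

lemma mat_type_exists:
  fixes A :: "'a::{field, finite} mat"
  assumes "n \<le> N"
  obtains ds where "mat_type n A ds" "monic_chain ds" "length ds = N" "sum_list (map degree ds) = n"
proof -
  let ?V = "supported n :: (nat \<Rightarrow> 'a) set"
  let ?span = "Modules.module.span (mat_op.act n A)"
  define v :: "nat \<Rightarrow> nat \<Rightarrow> 'a" where "v j = (if j < n then (\<lambda>k. if k = j then 1 else 0) else 0)" for j
  have v_in: "v j \<in> ?V" for j by (simp add: v_def supported_def)
  have act_in: "mat_op.act n A p f \<in> ?V" if "f \<in> ?V" for p f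
    by (rule mat_op.act_closed[OF subspace_supported mat_op_image that])
  have V: "?span (v ` {..<N}) = ?V"
  proof (rule subset_antisym)
    show "?span (v ` {..<N}) \<subseteq> ?V"
      unfolding mat_op.E.span_family mat_op.E.comb_def
      by (auto intro!: mat_op.vs1.subspace_sum[OF subspace_supported] act_in v_in)
    show "?V \<subseteq> ?span (v ` {..<N})"
    proof
      fix f assume f: "f \<in> ?V"
      have coord: "mat_op.act n A [:f j:] (v j) = (\<lambda>i. if i = j then f j else 0)" if "j < n" for j
        unfolding mat_op.act_const using that by (auto simp: fscale_def v_def fun_eq_iff)
      have "(\<Sum>j<m. mat_op.act n A [:f j:] (v j)) = (\<lambda>i. if i < m then f i else 0)" if "m \<le> n" for m
        using that
      proof (induction m)
        case (Suc m)
        then show ?case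
          by (auto simp: sum.lessThan_Suc coord fun_eq_iff less_Suc_eq)
      qed (simp add: zero_fun_def)
      from this[of n] have "f = (\<Sum>j<n. mat_op.act n A [:f j:] (v j))"
        using f by (auto simp: fun_eq_iff supported_def)
      moreover have "\<dots> \<in> ?span (v ` {..<N})"
        using assms by (intro mat_op.E.span_sum mat_op.E.span_scale mat_op.E.span_base) auto
      ultimately show "f \<in> ?span (v ` {..<N})" by metis
    qed
  qed
  obtain w d where span: "?span (w ` {..<N}) = ?V"
    and rel: "\<forall>p. mat_op.E.comb n A N p w = 0 \<longleftrightarrow> (\<forall>i<N. d i dvd p i)"
    and chain: "\<forall>i j. i \<le> j \<longrightarrow> j < N \<longrightarrow> d i dvd d j"
    using mat_op.E.diagonal_generators[of n A N v] unfolding V by (elim exE conjE) (rule that)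
  have nz: "d i \<noteq> 0" if i: "i < N" for i
  proof -
    have "w i \<in> ?V" using span mat_op.E.span_base[of "w i" "w ` {..<N}"] i by blast
    then obtain p where p: "p \<noteq> 0" "mat_op.act n A p (w i) = 0" by (rule torsion)
    have "mat_op.E.comb n A N (\<lambda>j. if j = i then p else 0) w =
          (\<Sum>j<N. if j = i then mat_op.act n A p (w j) else 0)"
      unfolding mat_op.E.comb_def by (intro sum.cong) auto
    then have "mat_op.E.comb n A N (\<lambda>j. if j = i then p else 0) w = 0" using i p by simp
    then have "d i dvd p" using rel i by (metis (mono_tags, lifting))
    then show ?thesis using p by auto
  qed
  define ds where "ds = map (\<lambda>i. smult (inverse (lead_coeff (d i))) (d i)) [0..<N]"
  have len: "length ds = N" by (simp add: ds_def)
  have dvd_iff: "ds ! i dvd p \<longleftrightarrow> d i dvd p" "p dvd ds ! i \<longleftrightarrow> p dvd d i" if "i < N" for i p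
    using that nz[OF that] by (simp_all add: ds_def smult_dvd_iff dvd_smult_iff)
  have "mat_op.cyclic_gens n A ?V ds w"
    using span rel by (simp add: mat_op.cyclic_gens_def mat_op.E.span_family len dvd_iff)
  then have type: "mat_type n A ds" by (auto simp: mat_op.cyclic_decomp_def)
  moreover have "monic_chain ds"
    unfolding monic_chain_def
  proof
    show "sorted_wrt (dvd) ds"
      using chain by (auto simp: sorted_wrt_iff_nth_less len dvd_iff)
    show "\<forall>d\<in>set ds. lead_coeff d = 1" using nz by (auto simp: ds_def)
  qed
  moreover have "\<forall>d\<in>set ds. d \<noteq> 0" using nz by (auto simp: ds_def)
  ultimately show ?thesis
    using that[of ds] len sum_degree_mat_type[of n A ds] by blast
qed

section \<open>Matrices with prescribed invariant factors\<close>

definition rscale :: "'a::field \<Rightarrow> (nat \<Rightarrow> 'a poly) \<Rightarrow> nat \<Rightarrow> 'a poly" where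
  "rscale c g = (\<lambda>i. smult c (g i))"

text \<open>
  Multiplication by the indeterminate on the direct sum of the rings of residues modulo the entries of
  \<open>ds\<close>, where residues are represented by reduced polynomials.
\<close>

definition residues_op :: "'a::field poly list \<Rightarrow> (nat \<Rightarrow> 'a poly) \<Rightarrow> nat \<Rightarrow> 'a poly" where
  "residues_op ds g = (\<lambda>i. if i < length ds then ([:0, 1:] * g i) mod ds ! i else 0)"

definition residues :: "'a::field poly list \<Rightarrow> (nat \<Rightarrow> 'a poly) set" where
  "residues ds = {g. (\<forall>i<length ds. g i mod ds ! i = g i) \<and> (\<forall>i\<ge>length ds. g i = 0)}"

lemma linear_operator_residues_op: "linear_operator rscale (residues_op ds)"
  for ds :: "'a::field poly list"
proof -
  interpret Vector_Spaces.vector_space "rscale :: 'a \<Rightarrow> _"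
    by unfold_locales (auto simp: rscale_def fun_eq_iff smult_add_right smult_add_left)
  have "pCons 0 (p + r) mod d = pCons 0 p mod d + pCons 0 r mod d" for p r d :: "'a poly"
    by (simp add: poly_mod_add_left[symmetric])
  then show ?thesis
    by unfold_locales
       (auto simp: residues_op_def rscale_def fun_eq_iff mod_smult_left[symmetric])
qed

interpretation residues_op: linear_operator rscale "residues_op ds" for ds :: "'a::field poly list"
  by (rule linear_operator_residues_op)

lemma subspace_residues: "Modules.module.subspace rscale (residues ds :: (nat \<Rightarrow> 'a::field poly) set)"
  by (rule residues_op.vs1.subspaceI)
     (auto simp: residues_def rscale_def poly_mod_add_left mod_smult_left)

lemma residues_op_closed: "residues_op ds g \<in> residues ds"
  by (simp add: residues_op_def residues_def)

lemma cyclic_decomp_residues: "residues_op.cyclic_decomp ds (residues ds) ds"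
  for ds :: "'a::field poly list"
proof -
  let ?N = "length ds"
  \<comment> \<open>The generators are the units of the summands; \<open>1 mod ds ! i\<close> is 0 when \<open>ds ! i = 1\<close>.\<close>
  define w :: "nat \<Rightarrow> nat \<Rightarrow> 'a poly" where "w i = (\<lambda>j. if j = i then 1 mod ds ! i else 0)" for i
  have act: "residues_op.act ds p (w i) = (\<lambda>j. if j = i then p mod ds ! i else 0)" if i: "i < ?N" for p i
  proof (induction p)
    case (pCons a p)
    have "pCons a p mod ds ! i = (smult a 1 + [:0, 1:] * p) mod ds ! i" by simp
    also have "\<dots> = smult a (1 mod ds ! i) + ([:0, 1:] * (p mod ds ! i)) mod ds ! i"
      unfolding poly_mod_add_left mod_smult_left mod_mult_right_eq ..
    finally show ?case
      unfolding residues_op.act_pCons pCons.IH using i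
      by (auto simp: w_def rscale_def residues_op_def fun_eq_iff)
  qed (simp add: zero_fun_def fun_eq_iff)
  have comb: "residues_op.E.comb ds ?N p w = (\<lambda>j. if j < ?N then p j mod ds ! j else 0)" for p
  proof -
    have "residues_op.E.comb ds k p w = (\<lambda>j. if j < k then p j mod ds ! j else 0)" if "k \<le> ?N" for k
      using that
    proof (induction k)
      case (Suc k)
      then show ?case
        by (auto simp: residues_op.E.comb_def sum.lessThan_Suc act fun_eq_iff less_Suc_eq)
    qed (simp add: residues_op.E.comb_def zero_fun_def)
    then show ?thesis by simp
  qed
  have "residues_op.cyclic_gens ds (residues ds) ds w"
    unfolding residues_op.cyclic_gens_def comb
  proof
    show "residues ds = range (\<lambda>p j. if j < ?N then p j mod ds ! j else 0)"
    proof
      show "residues ds \<subseteq> range (\<lambda>p j. if j < ?N then p j mod ds ! j else 0)"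
      proof
        fix g assume "g \<in> residues ds"
        then have "g = (\<lambda>j. if j < ?N then g j mod ds ! j else 0)"
          by (auto simp: residues_def fun_eq_iff)
        then show "g \<in> range (\<lambda>p j. if j < ?N then p j mod ds ! j else 0)"
          by (rule range_eqI[where x = g])
      qed
    qed (auto simp: residues_def)
    show "\<forall>p. (\<lambda>j. if j < ?N then p j mod ds ! j else 0) = 0 \<longleftrightarrow> (\<forall>i<?N. ds ! i dvd p i)"
      by (auto simp: fun_eq_iff dvd_eq_mod_eq_0)
  qed
  then show ?thesis by (auto simp: residues_op.cyclic_decomp_def)
qed

text \<open>
  Over a finite field the dimension can be read off from the cardinality, so a subspace with \<open>q ^ n\<close>
  elements has a basis of \<open>n\<close> vectors.
\<close>

lemma subspace_coordinates:
  fixes s :: "'a::{field, finite} \<Rightarrow> 'b::ab_group_add \<Rightarrow> 'b"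
  assumes vs: "Vector_Spaces.vector_space s" and V: "Modules.module.subspace s V"
    and card: "card V = CARD('a) ^ n"
  obtains b where "bij_betw b (supported n) V"
    "\<And>f g. b (f + g) = b f + b g" "\<And>c f. b (fscale c f) = s c (b f)"
proof -
  interpret Vector_Spaces.vector_space s by fact
  have fin: "finite V" by (rule card_ge_0_finite) (simp add: card)
  obtain B where B: "B \<subseteq> V" "independent B" "V \<subseteq> span B"
    using maximal_independent_subset[of V] by blast
  have span: "span B = V" using B V by (simp add: span_subspace)
  have finB: "finite B" using B(1) fin finite_subset by blast
  let ?m = "card B"
  obtain e where e: "bij_betw e {..<?m} B"
    using ex_bij_betw_nat_finite[OF finB] by (auto simp: atLeast0LessThan)
  define b where "b f = (\<Sum>i<?m. s (f i) (e i))" for f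
  have b: "b f = (\<Sum>x\<in>B. s (f (inv_into {..<?m} e x)) x)" for f
    unfolding b_def
    by (subst sum.reindex_bij_betw[OF e, symmetric])
       (use e in \<open>auto simp: bij_betw_def intro!: sum.cong\<close>)
  have add: "b (f + g) = b f + b g" for f g
    by (simp add: b_def scale_left_distrib sum.distrib)
  have scl: "b (fscale c f) = s c (b f)" for c f
    by (simp add: b_def fscale_def scale_sum_right)
  have "bij_betw b (supported ?m) V"
  proof (rule bij_betw_imageI)
    show "inj_on b (supported ?m)"
    proof (rule inj_onI)
      fix f g :: "nat \<Rightarrow> 'a" assume fg: "f \<in> supported ?m" "g \<in> supported ?m" "b f = b g"
      have "(\<Sum>x\<in>B. s ((f - g) (inv_into {..<?m} e x)) x) = 0"
        using fg(3) by (simp add: b scale_left_diff_distrib sum_subtractf)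
      then have zero: "(f - g) (inv_into {..<?m} e x) = 0" if "x \<in> B" for x

        using independentD[OF B(2) finB order_refl, of "\<lambda>x. (f - g) (inv_into {..<?m} e x)"] that by blast
      show "f = g"
      proof
        fix i
        show "f i = g i"
        proof (cases "i < ?m")
          case True
          then have "e i \<in> B" "inv_into {..<?m} e (e i) = i" using e by (auto simp: bij_betw_def)
          then show ?thesis using zero[of "e i"] by simp
        qed (use fg in \<open>simp add: supported_def\<close>)
      qed
    qed
    show "b ` supported ?m = V"
    proof
      show "b ` supported ?m \<subseteq> V"
        using e B(1) V
        by (auto simp: b_def bij_betw_def intro!: subspace_sum subspace_scale)
      show "V \<subseteq> b ` supported ?m"
      proof
        fix v assume "v \<in> V"
        then obtain u where u: "v = (\<Sum>x\<in>B. s (u x) x)"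
          using span span_finite[OF finB] by auto
        have "v = b (\<lambda>i. if i < ?m then u (e i) else 0)"
          unfolding u b_def by (subst sum.reindex_bij_betw[OF e, symmetric]) (auto intro: sum.cong)
        then show "v \<in> b ` supported ?m" 
          by (intro image_eqI) (auto simp: supported_def)
      qed
    qed
  qed
  moreover from this have "CARD('a) ^ ?m = CARD('a) ^ n"
    using bij_betw_same_card card card_supported by metis
  then have "?m = n" using one_less_card_field[where 'a = 'a] by simp
  ultimately show ?thesis using that add scl by simp
qed

text \<open>
  Multiplication by the indeterminate on the residues modulo \<open>ds\<close>, written in coordinates, is the
  required matrix. This replaces the block diagonal matrix of companion matrices.
\<close>

lemma mat_type_realised:
  fixes ds :: "'a::{field, finite} poly list"
  assumes nz: "\<forall>d\<in>set ds. d \<noteq> 0" and n: "sum_list (map degree ds) = n"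
  obtains A where "A \<in> carrier_mat n n" "mat_type n A ds"
proof -
  let ?V = "supported n :: (nat \<Rightarrow> 'a) set" and ?T = "residues_op ds"
  have "card (residues ds) = CARD('a) ^ n"
    using card_cyclic_decomp[OF linear_operator_residues_op cyclic_decomp_residues nz] by (simp add: n)
  then obtain b where bij: "bij_betw b ?V (residues ds)"
    and add: "\<And>f g. b (f + g) = b f + b g" and scl: "\<And>c f. b (fscale c f) = rscale c (b f)"
    using subspace_coordinates[OF residues_op.vs1.vector_space_axioms subspace_residues] by blast
  note sub = mat_op.vs1.subspace_add[OF subspace_supported] mat_op.vs1.subspace_scale[OF subspace_supported]
  define L where "L f = inv_into ?V b (?T (b f))" for f
  have LV: "L f \<in> ?V" and bL: "b (L f) = ?T (b f)" for f
    using bij residues_op_closed[of ds "b f"]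
    by (auto simp: L_def bij_betw_def inv_into_into f_inv_into_f)
  have inj: "f = g" if "b f = b g" "f \<in> ?V" "g \<in> ?V" for f g
    using that bij by (auto simp: bij_betw_def inj_on_def)
  have "L (f + g) = L f + L g" for f g
    by (rule inj) (simp_all add: LV sub bL add residues_op.add)
  moreover have "L (fscale c f) = fscale c (L f)" for c f
    by (rule inj) (simp_all add: LV sub bL scl residues_op.scale)
  ultimately obtain A where A: "A \<in> carrier_mat n n" "\<And>f. f \<in> ?V \<Longrightarrow> mat_op n A f = L f"
    using linear_eq_mat_op[of L n] LV by blast
  interpret pair: linear_operator_pair fscale "mat_op n A" rscale ?T
    by (simp add: linear_operator_pair_def linear_operator_mat_op linear_operator_residues_op)
  have "pair.intertwiner ?V (residues ds) b"
    using bij by (simp add: pair.intertwiner_def add scl A bL)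
  then have "mat_type n A ds"
    using pair.cyclic_decomp_pullback subspace_supported mat_op_image cyclic_decomp_residues by blast
  then show ?thesis using that A by blast
qed

section \<open>Counting divisor chains\<close>

definition divisor_chains :: "nat \<Rightarrow> nat \<Rightarrow> 'a::field poly list set" where
  "divisor_chains N n = {ds. length ds = N \<and> monic_chain ds \<and> sum_list (map degree ds) = n}"

text \<open>
  A conjugacy class consists of the matrices with a given list of invariant factors. The length \<open>N\<close> of the padded
  chains is free as long as \<open>n \<le> N\<close>, which is what lets one infinite product serve all \<open>n\<close>.
\<close>

lemma card_mat_conj_classes:
  assumes "n \<le> N"
  shows "card (mat_conj_classes TYPE('a::{field, finite}) n) = card (divisor_chains N n :: 'a poly list set)"
proof -
  define cls :: "'a poly list \<Rightarrow> 'a mat set" where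
    "cls ds = {B \<in> carrier_mat n n. mat_type n B ds}" for ds
  have nz: "\<forall>d\<in>set ds. d \<noteq> 0" if "ds \<in> divisor_chains N n" for ds :: "'a poly list"
    using that by (auto simp: divisor_chains_def monic_chain_def)
  have inj: "inj_on cls (divisor_chains N n)"
  proof (rule inj_onI)
    fix ds es assume ds: "ds \<in> divisor_chains N n" and es: "es \<in> divisor_chains N n" and eq: "cls ds = cls es"
    obtain A where A: "A \<in> carrier_mat n n" "mat_type n A ds"
      using mat_type_realised[OF nz[OF ds]] ds by (auto simp: divisor_chains_def)
    then have "mat_type n A es" using eq by (auto simp: cls_def)
    then show "ds = es"
      using mat_type_unique[OF A(2)] ds es by (simp add: divisor_chains_def)
  qed
  have "mat_conj_classes TYPE('a) n = cls ` divisor_chains N n"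
  proof
    show "mat_conj_classes TYPE('a) n \<subseteq> cls ` divisor_chains N n"
    proof
      fix C assume "C \<in> mat_conj_classes TYPE('a) n"
      then obtain A where A: "A \<in> carrier_mat n n" "C = orbit (GL TYPE('a) n) (mat_conj n) A"
        by (auto simp: mat_conj_classes_def orbits_def)
      obtain ds where ds: "mat_type n A ds" "monic_chain ds" "length ds = N" "sum_list (map degree ds) = n"
        using mat_type_exists[OF assms] .
      have "C = cls ds" using A orbit_of_mat_type[OF A(1) ds(1)] by (simp add: cls_def)
      then show "C \<in> cls ` divisor_chains N n" using ds by (auto simp: divisor_chains_def)
    qed
    show "cls ` divisor_chains N n \<subseteq> mat_conj_classes TYPE('a) n"
    proof
      fix C assume "C \<in> cls ` divisor_chains N n"
      then obtain ds where ds: "ds \<in> divisor_chains N n" "C = cls ds" by blast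
      obtain A where A: "A \<in> carrier_mat n n" "mat_type n A ds"
        using mat_type_realised[OF nz[OF ds(1)]] ds by (auto simp: divisor_chains_def)
      have "C = orbit (GL TYPE('a) n) (mat_conj n) A"
        using orbit_of_mat_type[OF A] ds by (simp add: cls_def)
      then show "C \<in> mat_conj_classes TYPE('a) n"
        using A by (auto simp: mat_conj_classes_def orbits_def)
    qed
  qed
  then show ?thesis by (simp add: card_image[OF inj])
qed

definition monics :: "nat \<Rightarrow> 'a::field poly set" where
  "monics k = {e. lead_coeff e = 1 \<and> degree e = k}"

lemma card_monics: "card (monics k :: 'a poly set) = CARD('a) ^ k"
  and finite_monics: "finite (monics k :: 'a::{field, finite} poly set)"
proof -
  let ?m = "monom 1 k :: 'a poly"
  have "bij_betw (\<lambda>r. r + ?m) (res_ker 0 ?m) (monics k)"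
  proof (rule bij_betw_byWitness[where f' = "\<lambda>e. e - ?m"])
    show "(\<lambda>r. r + ?m) ` res_ker 0 ?m \<subseteq> monics k"
      by (auto simp: res_ker_def monics_def degree_add_eq_right degree_monom_eq lead_coeff_add_le
          coeff_eq_0)
    show "(\<lambda>e. e - ?m) ` monics k \<subseteq> res_ker 0 ?m"
    proof
      fix r assume "r \<in> (\<lambda>e. e - ?m) ` monics k"
      then obtain e where e: "lead_coeff e = 1" "degree e = k" "r = e - ?m"
        by (auto simp: monics_def)
      then have "coeff r i = 0" if "i \<ge> k" for i
        using that by (cases "i = k") (auto simp: coeff_eq_0)
      then have "r = 0 \<or> degree r < k"
        by (metis leading_coeff_0_iff not_less)
      then show "r \<in> res_ker 0 ?m" by (simp add: res_ker_def degree_monom_eq)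
    qed
  qed auto
  then show "card (monics k :: 'a poly set) = CARD('a) ^ k" "finite (monics k :: 'a poly set)"
    using bij_betw_same_card bij_betw_finite card_res_ker_0[of ?m] finite_res_ker[of 0 ?m]
    by (metis degree_monom_eq one_neq_zero)+
qed

text \<open>
  The first entry \<open>e\<close> of a chain divides all the others, and the quotients form a chain that is shorter
  by one. As \<open>e\<close> occurs in all \<open>N + 1\<close> entries, it contributes \<open>(N + 1) * degree e\<close> to the sum of
  the degrees. The component \<open>i\<close> is the degree sum of the quotients.
\<close>

lemma bij_betw_chains_Suc:
  "bij_betw (\<lambda>(i, e, ds). e # map ((*) e) ds)
     (SIGMA i:{..n}. {e. lead_coeff e = 1 \<and> Suc N * degree e = n - i} \<times> divisor_chains N i)
     (divisor_chains (Suc N) n :: 'a::field poly list set)"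
proof (rule bij_betw_imageI)
  let ?S = "SIGMA i:{..n}. {e :: 'a poly. lead_coeff e = 1 \<and> Suc N * degree e = n - i} \<times> divisor_chains N i"
  let ?f = "\<lambda>(i::nat, e :: 'a poly, ds). e # map ((*) e) ds"
  let ?g = "\<lambda>es :: 'a poly list. (n - Suc N * degree (hd es), hd es, map (\<lambda>d. d div hd es) (tl es))"
  have deg: "sum_list (map degree (e # map ((*) e) ds)) = Suc N * degree e + sum_list (map degree ds)"
    if "e \<noteq> 0" "\<forall>d\<in>set ds. d \<noteq> 0" "length ds = N" for e :: "'a poly" and ds
  proof -
    have "sum_list (map degree (map ((*) e) ds)) = length ds * degree e + sum_list (map degree ds)"
      using that(1,2) by (induction ds) (auto simp: degree_mult_eq)
    then show ?thesis using that by simp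
  qed
  have chain: "monic_chain (e # map ((*) e) ds) \<longleftrightarrow> lead_coeff e = 1 \<and> monic_chain ds"
    for e :: "'a poly" and ds
    by (cases "e = 0") (auto simp: monic_chain_def sorted_wrt_map lead_coeff_mult)
  show "inj_on ?f ?S"
    by (rule inj_on_inverseI[where g = ?g]) (auto simp: o_def intro!: map_idI)
  have sub: "?f ` ?S \<subseteq> divisor_chains (Suc N) n"
  proof clarsimp
    fix i and e :: "'a poly" and ds :: "'a poly list"
    assume *: "i \<le> n" "lead_coeff e = 1" "degree e + N * degree e = n - i" "ds \<in> divisor_chains N i"
    then have "e \<noteq> 0" "\<forall>d\<in>set ds. d \<noteq> 0" "length ds = N" "sum_list (map degree ds) = i" "monic_chain ds"
      by (auto simp: divisor_chains_def monic_chain_def)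
    then show "e # map ((*) e) ds \<in> divisor_chains (Suc N) n"
      using * deg[of e ds] chain[of e ds] by (simp add: divisor_chains_def)
  qed
  have sup: "es \<in> ?f ` ?S" if es: "es \<in> divisor_chains (Suc N) n" for es :: "'a poly list"
  proof -
    obtain e es' where es': "es = e # es'" "length es' = N" using es by (cases es) (auto simp: divisor_chains_def)
    define ds where "ds = map (\<lambda>d. d div e) es'"
    have "\<forall>d\<in>set es'. e dvd d" "lead_coeff e = 1"
      using es by (auto simp: divisor_chains_def monic_chain_def es')
    then have map: "map ((*) e) ds = es'"
      unfolding ds_def by (auto simp: o_def intro!: map_idI)
    have mc: "monic_chain (e # map ((*) e) ds)" using es by (simp add: divisor_chains_def es' map)
    then have c: "lead_coeff e = 1" "monic_chain ds" unfolding chain by auto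
    have nz: "e \<noteq> 0" "\<forall>d\<in>set ds. d \<noteq> 0" using c by (auto simp: monic_chain_def)
    have len: "length ds = N" by (simp add: ds_def es')
    define i where "i = sum_list (map degree ds)"
    have "n = Suc N * degree e + i"
      using deg[OF nz len] es by (simp add: divisor_chains_def es' map i_def)
    then show ?thesis
      using c len by (intro image_eqI[of _ _ "(i, e, ds)"]) (auto simp: es' map divisor_chains_def i_def)
  qed
  show "?f ` ?S = divisor_chains (Suc N) n"
    using sub sup by blast
qed

lemma card_chains_Suc:
  "card (divisor_chains (Suc N) n :: 'a::{field, finite} poly list set) =
     (\<Sum>i\<le>n. card (divisor_chains N i :: 'a poly list set) *
        (if Suc N dvd n - i then CARD('a) ^ ((n - i) div Suc N) else 0))"
proof -
  let ?M = "\<lambda>N m. {e :: 'a poly. lead_coeff e = 1 \<and> Suc N * degree e = m}"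
  have M: "?M N m = (if Suc N dvd m then monics (m div Suc N) else {})" for N m
  proof -
    have "Suc N * k = m \<longleftrightarrow> Suc N dvd m \<and> k = m div Suc N" for k
      by (auto simp del: mult_Suc)
    then show ?thesis by (auto simp: monics_def simp del: mult_Suc)
  qed
  have finM: "finite (?M N m)" for N m unfolding M by (simp add: finite_monics)
  have fin: "finite (divisor_chains N n :: 'a poly list set)" for N n
  proof (induction N arbitrary: n)
    case 0
    show ?case by (rule finite_subset[of _ "{[]}"]) (auto simp: divisor_chains_def)
  next
    case (Suc N)
    have "finite (SIGMA i:{..n}. ?M N (n - i) \<times> (divisor_chains N i :: 'a poly list set))"
      by (intro finite_SigmaI finite_cartesian_product finM Suc.IH) auto
    then show ?case using bij_betw_finite[OF bij_betw_chains_Suc[of n N]] by blast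
  qed
  have "card (divisor_chains (Suc N) n :: 'a poly list set) =
        card (SIGMA i:{..n}. ?M N (n - i) \<times> (divisor_chains N i :: 'a poly list set))"
    by (rule bij_betw_same_card[OF bij_betw_chains_Suc, symmetric])
  also have "\<dots> = (\<Sum>i\<le>n. card (?M N (n - i) \<times> (divisor_chains N i :: 'a poly list set)))"
    by (rule card_SigmaI) (intro ballI finite_cartesian_product finM fin | simp)+
  also have "\<dots> = (\<Sum>i\<le>n. card (divisor_chains N i :: 'a poly list set) *
        (if Suc N dvd n - i then CARD('a) ^ ((n - i) div Suc N) else 0))"
    unfolding M by (intro sum.cong) (auto simp: card_cartesian_product card_monics)
  finally show ?thesis .
qed

lemma geometric_fps:
  fixes c :: "'b::field"
  assumes "k > 0"
  shows "1 / (1 - fps_const c * fps_X ^ k) = Abs_fps (\<lambda>m. if k dvd m then c ^ (m div k) else 0)"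
    (is "1 / ?D = ?G")
proof -
  have "?G * ?D = 1"
  proof (rule fps_ext)
    fix m
    have "fps_nth (?G * ?D) m = fps_nth ?G m - c * (if m < k then 0 else fps_nth ?G (m - k))"
      by (simp add: right_diff_distrib fps_X_power_mult_right_nth mult.left_commute[of ?G] mult.assoc)
    also have "\<dots> = fps_nth 1 m"
    proof (cases "m < k")
      case True
      then show ?thesis using assms by (cases "m = 0") (auto dest: dvd_imp_le)
    next
      case False
      then obtain j where j: "m = j + k" by (metis add.commute le_Suc_ex not_less)
      then show ?thesis using assms by (simp add: div_add_self2)
    qed
    finally show "fps_nth (?G * ?D) m = fps_nth 1 m" .
  qed
  then have "inverse ?D = ?G" by (intro fps_inverse_unique) (simp add: mult.commute)
  moreover have "fps_nth ?D 0 \<noteq> 0" using assms by simp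
  ultimately show ?thesis by (simp add: fps_divide_unit)
qed

text \<open>
  Splitting off the first entry multiplies the generating function by the geometric series that counts
  the \<open>q ^ k\<close> monic polynomials of degree \<open>k\<close> with weight \<open>(N + 1) * k\<close>.
\<close>

lemma chains_fps:
  "Abs_fps (\<lambda>n. of_nat (card (divisor_chains N n :: 'a::{field, finite} poly list set))) =
   (\<Prod>r<N. 1 / (1 - of_nat CARD('a) * fps_X ^ (r + 1)) :: rat fps)"
proof (induction N)
  case 0
  have "divisor_chains 0 n = (if n = 0 then {[]} else ({} :: 'a poly list set))" for n
    by (auto simp: divisor_chains_def monic_chain_def)
  then show ?case by (auto simp: fps_eq_iff)
next
  case (Suc N)
  have "Abs_fps (\<lambda>n. of_nat (card (divisor_chains (Suc N) n :: 'a poly list set))) =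
        Abs_fps (\<lambda>n. of_nat (card (divisor_chains N n :: 'a poly list set))) *
        (1 / (1 - of_nat CARD('a) * fps_X ^ Suc N) :: rat fps)"
    unfolding fps_of_nat[symmetric] geometric_fps[OF zero_less_Suc]
    by (rule fps_ext) (auto simp: fps_mult_nth card_chains_Suc atLeast0AtMost intro!: sum.cong)
  then show ?case unfolding Suc.IH by (simp add: sum.lessThan_Suc prod.lessThan_Suc)
qed

theorem theorem20:
  fixes q :: nat and a :: "nat \<Rightarrow> nat"
  assumes "primepow q"
    and "CARD('a::{field, finite}) = q"
    and "\<And>n. n \<ge> 1 \<Longrightarrow> a n = card (mat_conj_classes TYPE('a) n)"
  shows "(\<lambda>r. 1 / (1 - of_nat q * fps_X ^ (r + 1)))
           has_prod (1 + Abs_fps (\<lambda>n. if n \<ge> 1 then of_nat (a n) else 0) :: rat fps)"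
proof -
  let ?f = "\<lambda>r. 1 / (1 - of_nat q * fps_X ^ (r + 1)) :: rat fps"
  let ?L = "1 + Abs_fps (\<lambda>n. if n \<ge> 1 then of_nat (a n) else 0) :: rat fps"
  have partial: "(\<Prod>r\<le>N. ?f r) = Abs_fps (\<lambda>n. of_nat (card (divisor_chains (Suc N) n :: 'a poly list set)))" for N
    unfolding chains_fps assms(2) lessThan_Suc_atMost ..
  have nth: "fps_nth (\<Prod>r\<le>N. ?f r) n = fps_nth ?L n" if "n \<le> N" for n N
  proof (cases "n = 0")
    case True
    have "fps_nth (\<Prod>r\<le>N. ?f r) 0 = 1" by (induction N) (simp_all add: fps_divide_unit)
    then show ?thesis using True by simp
  next
    case False
    have "card (divisor_chains (Suc N) n :: 'a poly list set) = a n"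
      using card_mat_conj_classes[of n "Suc N", where 'a = 'a] assms(3)[of n] that False by simp
    then show ?thesis using False unfolding partial by simp
  qed
  have "(\<lambda>N. \<Prod>r\<le>N. ?f r) \<longlonglongrightarrow> ?L"
  proof (rule tendsto_fpsI)
    fix n
    show "\<forall>\<^sub>F N in sequentially. fps_nth (\<Prod>r\<le>N. ?f r) n = fps_nth ?L n"
      using eventually_ge_at_top[of n] by eventually_elim (rule nth)
  qed
  moreover have "fps_nth ?L 0 \<noteq> 0" by simp
  then have "?L \<noteq> 0" by (metis fps_zero_nth)
  ultimately show ?thesis by (simp add: has_prod_def raw_has_prod_def)
qed

end
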